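(* Let $X=C_n(\mathbb{R}^2)=\{(x_1,\dots,x_n)\in(\mathbb{R}^2)^n : x_i\neq x_j \text{ for } i\neq j\}$ be the configuration space of $n$ distinct ordered points in the plane. Then every motion planner in $X$ (that is, every motion planner for collision free motion of $n$ distinct points on the plane $\mathbb{R}^2$) has order of instability at least $2n-2$, and there exist motion planners in $X$ having order of instability equal to $2n-2$.
   Context: For a topological space $X$, let $PX$ be the space of all continuous paths $\gamma:[0,1]\to X$ with the compact-open topology, and let $\pi:PX\to X\times X$, $\pi(\gamma)=(\gamma(0),\gamma(1))$. A motion planner in $X$ is given by finitely many subsets $F_1,\dots,F_k\subset X\times X$ and continuous maps $s_i:F_i\to PX$ ($i=1,\dots,k$) such that: (a) the sets $F_1,\dots,F_k$ are pairwise disjoint and cover $X\times X$; (b) $\pi\circ s_i=1_{F_i}$ for every $i$; (c) each $F_i$ is an ENR (Euclidean neighbourhood retract). The order of instability of a motion planner is the largest integer $r$ such that there are indices $1\le i_1<i_2<\dots<i_r\le k$ with $\bar F_{i_1}\cap\bar F_{i_2}\cap\dots\cap\bar F_{i_r}\neq\emptyset$ (closures taken in $X\times X$).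
   Formalization: The number of points n is assumed to be at least 2; for n = 1 the space is the plane, every motion planner has order of instability at least 1, and none has order 2n-2 = 0, so the claim as written fails there (and for n = 0 the number 2n-2 is negative). *)

theory Defs
  imports "HOL-Analysis.Analysis"
begin

definition config_space :: "('a ^ 'n) set" where
  "config_space = {x. \<forall>i j. i \<noteq> j \<longrightarrow> x $ i \<noteq> x $ j}"

text \<open>A path is a function on the unit interval; the restriction to \<^term>\<open>extensional {0..1::real}\<close>
  picks one total function for each path.\<close>

definition paths :: "'a topology \<Rightarrow> (real \<Rightarrow> 'a) set" where
  "paths X = {\<gamma> \<in> extensional {0..1}. pathin X \<gamma>}"

text \<open>The compact-open topology on \<^term>\<open>paths X\<close>.\<close>

definition path_space :: "'a topology \<Rightarrow> (real \<Rightarrow> 'a) topology" where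
  "path_space X = topology_generated_by
     {{\<gamma> \<in> paths X. \<gamma> ` K \<subseteq> U} | K U. compact K \<and> K \<subseteq> {0..1} \<and> openin X U}"

lemma topspace_path_space [simp]: "topspace (path_space X) = paths X"
proof -
  have "{\<gamma> \<in> paths X. \<gamma> ` {} \<subseteq> {}} \<in>
      {{\<gamma> \<in> paths X. \<gamma> ` K \<subseteq> U} | K U. compact K \<and> K \<subseteq> {0..1} \<and> openin X U}"
    by blast
  then show ?thesis
    unfolding path_space_def topology_generated_by_topspace by auto
qed

definition path_ends :: "(real \<Rightarrow> 'a) \<Rightarrow> 'a \<times> 'a" where
  "path_ends \<gamma> = (\<gamma> 0, \<gamma> 1)"

definition motion_planner ::
  "'a::euclidean_space set \<Rightarrow> nat \<Rightarrow> (nat \<Rightarrow> ('a \<times> 'a) set) \<Rightarrow> (nat \<Rightarrow> 'a \<times> 'a \<Rightarrow> real \<Rightarrow> 'a) \<Rightarrow> bool"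
where
  "motion_planner X k F s \<longleftrightarrow>
     disjoint_family_on F {1..k} \<and>
     (\<Union>i\<in>{1..k}. F i) = X \<times> X \<and>
     (\<forall>i\<in>{1..k}. continuous_map (top_of_set (F i)) (path_space (top_of_set X)) (s i)) \<and>
     (\<forall>i\<in>{1..k}. \<forall>p\<in>F i. path_ends (s i p) = p) \<and>
     (\<forall>i\<in>{1..k}. ENR (F i))"

text \<open>The sets \<open>I\<close> are the sets of indices \<open>i\<^sub>1 < \<dots> < i\<^sub>r\<close>, with \<open>r = card I\<close>. The empty
  index set, whose intersection is \<^term>\<open>UNIV\<close>, contributes \<open>r = 0\<close>, so the maximum is always over
  a nonempty finite set.\<close>

definition order_of_instability ::
  "'a::topological_space set \<Rightarrow> nat \<Rightarrow> (nat \<Rightarrow> ('a \<times> 'a) set) \<Rightarrow> nat"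
where
  "order_of_instability X k F =
     Max {card I | I. I \<subseteq> {1..k} \<and> (\<Inter>i\<in>I. top_of_set (X \<times> X) closure_of F i) \<noteq> {}}"

end

theory Submission
  imports Defs
begin

text \<open>
  Lower bound. Points of the plane can be placed on concentric circles in two opposite orders, so that
  the pairs of such configurations contain a torus \<open>(S\<^sup>1)\<^sup>m\<close> with \<open>m = 2n - 3\<close> on which the winding numbers
  of the differences of points along a motion, corrected by the explicit angles at its two ends, form a
  locally constant, \<open>\<int>\<^sup>m\<close>-equivariant function from the preimage of each \<open>F\<^sub>i\<close> in \<open>\<real>\<^sup>m\<close> to \<open>\<int>\<^sup>m\<close>. If at most \<open>m\<close>
  closures met at a time, a partition of unity would average these functions to a continuous map at bounded
  distance from the identity, hence onto by Brouwer's theorem, whose image lies in countably many simplices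
  of dimension less than \<open>m\<close>. The proof works in \<open>\<real>\<^sup>n \<times> \<real>\<^sup>n\<close>, with three idle coordinates.

  Upper bound. Project a configuration to the line through two fixed points of it. The number of
  distinct projections lies between 2 and \<open>n\<close>, and while it is constant the points can be moved
  continuously to the orthogonal line; the two orthogonal lines are then matched by a rotation, which is
  continuous off the locus of opposite directions and on it. Grouping by the two numbers of projections and
  the coincidence of opposite directions gives \<open>2n - 2\<close> strata.
\<close>

section \<open>Equivariant covers of Euclidean space\<close>

text \<open>For a target \<open>y\<close>, the map taking \<open>z\<close> to
  \<open>y + (z - G z)\<close> sends \<open>cball y B\<close> into itself; a Brouwer fixed point of
  it solves \<open>G z = y\<close>.\<close>

lemma surj_if_bounded_displacement:
  fixes G :: "'a::euclidean_space \<Rightarrow> 'a"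
  assumes cont: "continuous_on UNIV G" and bd: "\<And>x. norm (G x - x) \<le> B"
  shows "surj G"
proof -
  have "\<exists>x\<in>cball y B. G x = y" for y
  proof (rule brouwer_surjective)
    show "cball y B \<noteq> {}"
      using bd[of 0] norm_ge_zero[of "G 0 - 0"] by (simp only: cball_eq_empty)
    show "continuous_on (cball y B) G"
      using cont continuous_on_subset by blast
    show "x + (z - G z) \<in> cball y B" if "x \<in> {y}" "z \<in> cball y B" for x z
      using that bd[of z] by (simp add: dist_norm)
  qed auto
  then show ?thesis
    by (metis surjI)
qed

section \<open>Integer points and translated subspaces\<close>

definition integer_points :: "'a::euclidean_space set" where
  "integer_points = {x. \<forall>b\<in>Basis. x \<bullet> b \<in> \<int>}"

lemma integer_points_diff: "x \<in> integer_points \<Longrightarrow> y \<in> integer_points \<Longrightarrow> x - y \<in> integer_points"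
  and integer_points_minus: "x \<in> integer_points \<Longrightarrow> - x \<in> integer_points"
  by (auto simp: integer_points_def inner_add_left inner_diff_left)

lemma countable_integer_points: "countable (integer_points :: 'a::euclidean_space set)"
proof -
  let ?h = "\<lambda>g. \<Sum>b\<in>Basis. g b *\<^sub>R (b::'a)"
  have "integer_points \<subseteq> ?h ` (Basis \<rightarrow>\<^sub>E \<int>)"
  proof
    fix x :: 'a assume x: "x \<in> integer_points"
    have "x = ?h (restrict (\<lambda>b. x \<bullet> b) Basis)"
      by (subst (1) euclidean_representation[symmetric]) simp
    moreover have "restrict (\<lambda>b. x \<bullet> b) Basis \<in> Basis \<rightarrow>\<^sub>E \<int>"
      using x by (auto simp: integer_points_def)
    ultimately show "x \<in> ?h ` (Basis \<rightarrow>\<^sub>E \<int>)" by blast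
  qed
  moreover have "countable (\<int> :: real set)"
    unfolding Ints_def by simp
  then have "countable (Basis \<rightarrow>\<^sub>E (\<int> :: real set))"
    by (intro countable_PiE) auto
  ultimately show ?thesis
    by (rule countable_subset[OF _ countable_image])
qed

lemma integer_part:
  fixes x :: "'a::euclidean_space"
  obtains y z where "x = y + z" "y \<in> cbox 0 One" "z \<in> integer_points"
proof
  let ?z = "\<Sum>b\<in>Basis. of_int \<lfloor>x \<bullet> b\<rfloor> *\<^sub>R b"
  show "x = (x - ?z) + ?z" by simp
  show "x - ?z \<in> cbox 0 One"
    by (auto simp: mem_box inner_diff_left) linarith
  show "?z \<in> integer_points"
    by (auto simp: integer_points_def)
qed

lemma negligible_translated_span:
  fixes B :: "'a::euclidean_space set"
  assumes "finite B" "card B < DIM('a)"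
  shows "negligible ((+) w ` span B)"
proof -
  have "dim (span B) < DIM('a)"
    using assms dim_le_card'[of B] by simp
  then show ?thesis
    by (intro negligible_translation negligible_lowdim)
qed

lemma infdist_translation:
  fixes z :: "'a::real_normed_vector"
  assumes "\<And>y. y + z \<in> S \<longleftrightarrow> y \<in> S"
  shows "infdist (x + z) S = infdist x S"
proof -
  have "S = (\<lambda>y. y + z) ` S"
    using assms by (auto simp: image_iff) (metis diff_add_cancel)
  then have "dist (x + z) ` S = (dist (x + z) \<circ> (\<lambda>y. y + z)) ` S"
    by (metis image_comp)
  also have "\<dots> = dist x ` S"
    by (auto simp: o_def dist_norm)
  finally show ?thesis
    unfolding infdist_def by metis
qed

text \<open>The map \<open>\<pi>\<close> and the set \<open>B\<close>, whose span contains the range of \<open>id - \<pi>\<close>, allow for coordinates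
  that the functions \<open>f i\<close> do not see.\<close>

locale lattice_cover =
  fixes K :: "'i set" and A :: "'i \<Rightarrow> 'a::euclidean_space set" and f :: "'i \<Rightarrow> 'a \<Rightarrow> 'a"
    and \<pi> :: "'a \<Rightarrow> 'a" and B :: "'a set"
  assumes finite_K: "finite K"
    and cover: "(\<Union>i\<in>K. A i) = UNIV"
    and invariant: "\<And>i x z. i \<in> K \<Longrightarrow> x \<in> A i \<Longrightarrow> z \<in> integer_points \<Longrightarrow> x + z \<in> A i"
    and equivariant: "\<And>i x z. i \<in> K \<Longrightarrow> x \<in> A i \<Longrightarrow> z \<in> integer_points \<Longrightarrow> f i (x + z) = f i x + \<pi> z"
    and f_integer: "\<And>i x. i \<in> K \<Longrightarrow> x \<in> A i \<Longrightarrow> f i x \<in> integer_points"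
    and f_local: "\<And>i x. i \<in> K \<Longrightarrow> x \<in> A i \<Longrightarrow> \<exists>r>0. \<forall>y\<in>A i. dist x y < r \<longrightarrow> f i y = f i x"
    and linear: "linear \<pi>"
    and finite_B: "finite B"
    and diff_span: "\<And>x. x - \<pi> x \<in> span B"
begin

section \<open>Open enlargements of the covering sets\<close>

definition good :: "'i \<Rightarrow> 'a \<Rightarrow> real \<Rightarrow> bool" where
  "good i a r \<longleftrightarrow> a \<in> A i \<and> r > 0 \<and> (\<forall>y\<in>A i. dist a y < 2 * r \<longrightarrow> f i y = f i a) \<and>
     (\<forall>j\<in>K. (\<exists>y\<in>A j. dist a y < 2 * r) \<longrightarrow> a \<in> closure (A j))"

definition V :: "'i \<Rightarrow> 'a set" where
  "V i = {x. \<exists>a r. good i a r \<and> dist x a < r}"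

text \<open>The choice of \<open>a\<close> is immaterial by \<open>good_unique\<close>; for
  \<open>i\<close> in \<open>K\<close> this extends \<open>f i\<close> from \<open>A i\<close> to a
  locally constant function on the open set \<open>V i\<close>.\<close>

definition ext :: "'i \<Rightarrow> 'a \<Rightarrow> 'a" where
  "ext i x = f i (SOME a. \<exists>r. good i a r \<and> dist x a < r)"

lemma goodI:
  assumes "a \<in> A i" "r > 0" "\<And>y. y \<in> A i \<Longrightarrow> dist a y < 2 * r \<Longrightarrow> f i y = f i a"
    "\<And>j y. j \<in> K \<Longrightarrow> y \<in> A j \<Longrightarrow> dist a y < 2 * r \<Longrightarrow> a \<in> closure (A j)"
  shows "good i a r"
  using assms unfolding good_def by blast

lemma goodD:
  assumes "good i a r"
  shows "a \<in> A i" "r > 0" "y \<in> A i \<Longrightarrow> dist a y < 2 * r \<Longrightarrow> f i y = f i a"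
    "j \<in> K \<Longrightarrow> y \<in> A j \<Longrightarrow> dist a y < 2 * r \<Longrightarrow> a \<in> closure (A j)"
  using assms unfolding good_def by blast+

text \<open>Local constancy, and avoidance of each \<open>A j\<close> whose closure misses
  \<open>a\<close>, are finitely many conditions that all hold for small radii.\<close>

lemma good_exists:
  assumes i: "i \<in> K" and a: "a \<in> A i"
  shows "\<exists>r. good i a r"
proof -
  obtain r0 where r0: "r0 > 0" "\<And>y. y \<in> A i \<Longrightarrow> dist a y < r0 \<Longrightarrow> f i y = f i a"
    using f_local[OF i a] by blast
  have "\<forall>j\<in>K. \<forall>\<^sub>F r in at_right 0. (\<exists>y\<in>A j. dist a y < 2 * r) \<longrightarrow> a \<in> closure (A j)"
  proof
    fix j assume "j \<in> K"
    show "\<forall>\<^sub>F r in at_right 0. (\<exists>y\<in>A j. dist a y < 2 * r) \<longrightarrow> a \<in> closure (A j)"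
    proof (cases "a \<in> closure (A j)")
      case False
      then obtain e where e: "e > 0" "\<And>y. y \<in> A j \<Longrightarrow> \<not> dist y a < e"
        by (auto simp: closure_approachable)
      have "\<forall>\<^sub>F r in at_right 0. r < e / 2"
        using e(1) by (intro eventually_at_right_real[of 0 "e / 2", THEN eventually_mono]) auto
      then show ?thesis
        by eventually_elim (use e(2) in \<open>force simp: dist_commute\<close>)
    qed auto
  qed
  then have "\<forall>\<^sub>F r in at_right 0. \<forall>j\<in>K. (\<exists>y\<in>A j. dist a y < 2 * r) \<longrightarrow> a \<in> closure (A j)"
    using finite_K by (simp add: eventually_ball_finite)
  moreover have "\<forall>\<^sub>F r in at_right 0. r \<in> {0<..<r0 / 2}"
    using r0(1) by (intro eventually_at_right_real) auto
  ultimately have "\<forall>\<^sub>F r in at_right 0. good i a r"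
  proof eventually_elim
    case (elim r)
    then have "f i y = f i a" if "y \<in> A i" "dist a y < 2 * r" for y
      using r0(2)[OF that(1)] that(2) by simp
    with elim a show ?case
      by (auto intro!: goodI)
  qed
  then show ?thesis
    by (metis eventually_happens trivial_limit_at_right_real)
qed

lemma A_subset_V: "i \<in> K \<Longrightarrow> A i \<subseteq> V i"
  using good_exists goodD(2) unfolding V_def by fastforce

lemma open_V: "open (V i)"
proof -
  have "V i = (\<Union>(a, r)\<in>{(a, r). good i a r}. ball a r)"
    by (force simp: V_def dist_commute)
  then show ?thesis by auto
qed

text \<open>If two good balls share a point, the centre of the smaller lies within twice the larger
  radius of the other centre; hence the factor 2 in \<open>good\<close>.\<close>

lemma good_unique:
  assumes "good i a r" "dist x a < r" "good i b s" "dist x b < s"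
  shows "f i a = f i b"
proof -
  have *: "f i a = f i b" if "good i a r" "dist x a < r" "good i b s" "dist x b < s" "s \<le> r" for a b r s
  proof -
    have "dist a b < 2 * r"
      using that dist_triangle[of a b x] by (simp add: dist_commute)
    then show ?thesis
      using goodD(3)[OF that(1), of b] goodD(1)[OF that(3)] by simp
  qed
  show ?thesis
    using *[of a r b s] *[of b s a r] assms by (cases "s \<le> r") auto
qed

lemma ext_eq:
  assumes "good i a r" "dist x a < r"
  shows "ext i x = f i a"
proof -
  have "\<exists>s. good i (SOME a. \<exists>r. good i a r \<and> dist x a < r) s \<and>
          dist x (SOME a. \<exists>r. good i a r \<and> dist x a < r) < s"
    using assms by (intro someI_ex[of "\<lambda>a. \<exists>r. good i a r \<and> dist x a < r"]) blast
  then show ?thesis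
    unfolding ext_def using assms good_unique by blast
qed

lemma ext_locally_constant:
  assumes "x \<in> V i"
  shows "\<forall>\<^sub>F y in nhds x. ext i y = ext i x"
proof -
  obtain a r where a: "good i a r" "dist x a < r"
    using assms by (auto simp: V_def)
  then have "\<forall>\<^sub>F y in nhds x. y \<in> ball a r"
    by (intro eventually_nhds_in_open) (auto simp: dist_commute)
  then show ?thesis
    by eventually_elim (use a ext_eq in \<open>force simp: dist_commute\<close>)
qed

lemma ext_integer:
  assumes "i \<in> K" "x \<in> V i"
  shows "ext i x \<in> integer_points"
proof -
  obtain a r where "good i a r" "dist x a < r"
    using assms by (auto simp: V_def)
  then show ?thesis
    using f_integer[OF assms(1), of a] ext_eq[of i a r x] goodD(1)[of i a r] by simp
qed

lemma invariant_iff: "i \<in> K \<Longrightarrow> z \<in> integer_points \<Longrightarrow> x + z \<in> A i \<longleftrightarrow> x \<in> A i"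
  using invariant[of i "x + z" "- z"] invariant[of i x z] integer_points_minus[of z] by auto

lemma good_translate:
  assumes i: "i \<in> K" and g: "good i a r" and z: "z \<in> integer_points"
  shows "good i (a + z) r"
proof -
  have *: "\<exists>y'. y = y' + z" for y
    by (metis diff_add_cancel)
  have cl: "a + z \<in> closure (A j)" if "j \<in> K" "a \<in> closure (A j)" for j
  proof (unfold closure_approachable, intro allI impI)
    fix e :: real assume "e > 0"
    then obtain y where "y \<in> A j" "dist y a < e"
      using \<open>a \<in> closure (A j)\<close> by (auto simp: closure_approachable)
    then show "\<exists>y\<in>A j. dist y (a + z) < e"
      using invariant[OF \<open>j \<in> K\<close> _ z] by (intro bexI[of _ "y + z"]) auto
  qed
  have a: "a \<in> A i" using g by (rule goodD)
  have "f i y = f i (a + z)" if "y \<in> A i" "dist (a + z) y < 2 * r" for y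
  proof -
    obtain y' where y: "y = y' + z" using * by blast
    then have y': "y' \<in> A i" using that i z invariant_iff by blast
    moreover have "dist a y' < 2 * r" using that y by simp
    ultimately have "f i y' = f i a"
      using goodD(3)[OF g] by blast
    then show ?thesis
      using equivariant[OF i a z] equivariant[OF i y' z] y by simp
  qed
  moreover have "a + z \<in> closure (A j)" if "j \<in> K" "y \<in> A j" "dist (a + z) y < 2 * r" for j y
  proof -
    obtain y' where y: "y = y' + z" using * by blast
    then have "y' \<in> A j" using that z invariant_iff by blast
    moreover have "dist a y' < 2 * r" using that y by simp
    ultimately have "a \<in> closure (A j)"
      using goodD(4)[OF g that(1)] by blast
    then show ?thesis
      using cl that(1) by blast
  qed
  ultimately show ?thesis
    by (rule goodI[OF invariant[OF i a z] goodD(2)[OF g]])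
qed

lemma V_translate_imp:
  assumes "i \<in> K" "z \<in> integer_points" "x \<in> V i"
  shows "x + z \<in> V i" "ext i (x + z) = ext i x + \<pi> z"
proof -
  obtain a r where a: "good i a r" "dist x a < r"
    using assms by (auto simp: V_def)
  have g: "good i (a + z) r" "dist (x + z) (a + z) < r"
    using good_translate assms a by auto
  then show "x + z \<in> V i"
    unfolding V_def by blast
  show "ext i (x + z) = ext i x + \<pi> z"
    using ext_eq[OF a] ext_eq[OF g] equivariant[of i a z] goodD(1)[OF a(1)] assms by simp
qed

lemma V_translate: "i \<in> K \<Longrightarrow> z \<in> integer_points \<Longrightarrow> x + z \<in> V i \<longleftrightarrow> x \<in> V i"
  using V_translate_imp(1)[of i z x] V_translate_imp(1)[of i "- z" "x + z"] integer_points_minus[of z]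
  by auto

text \<open>Among good balls witnessing \<open>x \<in> V i\<close>, take one of largest radius. The
  other centres lie in its double, so by \<open>good\<close> its own centre belongs to all the
  closures. Thus the sets \<open>V i\<close> overlap no more deeply than the closures of the
  \<open>A i\<close>.\<close>

lemma nerve:
  "(\<Inter>i\<in>{i\<in>K. x \<in> V i}. closure (A i)) \<noteq> {}"
proof -
  let ?J = "{i\<in>K. x \<in> V i}"
  have "\<forall>i\<in>?J. \<exists>p. good i (fst p) (snd p) \<and> dist x (fst p) < snd p"
    by (auto simp: V_def)
  then obtain p where p: "\<And>i. i \<in> ?J \<Longrightarrow> good i (fst (p i)) (snd (p i)) \<and> dist x (fst (p i)) < snd (p i)"
    by metis
  have "?J \<noteq> {}"
    using cover A_subset_V by blast
  moreover have fin: "finite ?J" using finite_K by auto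
  ultimately have "Max ((\<lambda>i. snd (p i)) ` ?J) \<in> (\<lambda>i. snd (p i)) ` ?J"
    by (intro Max_in) auto
  then obtain m where m: "m \<in> ?J" "snd (p m) = Max ((\<lambda>i. snd (p i)) ` ?J)"
    by auto
  have "fst (p m) \<in> closure (A j)" if j: "j \<in> ?J" for j
  proof -
    have "snd (p j) \<le> snd (p m)"
      using m(2) fin j by auto
    then have "dist (fst (p m)) (fst (p j)) < 2 * snd (p m)"
      using p[OF j] p[OF m(1)] dist_triangle[of "fst (p m)" "fst (p j)" x] by (simp add: dist_commute)
    then show ?thesis
      using p[OF j] p[OF m(1)] j goodD(1,4) by blast
  qed
  then show ?thesis by blast
qed

section \<open>An invariant partition of unity\<close>

definition \<psi> :: "'i \<Rightarrow> 'a \<Rightarrow> real" where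
  "\<psi> i x = (if V i = UNIV then 1 else infdist x (- V i))"

text \<open>Cutting \<^term>\<open>\<psi>\<close> off below a threshold makes the support of \<open>\<phi> i\<close> a closed subset of \<open>V i\<close>,
  so that \<open>\<phi> i x *\<^sub>R ext i x\<close> is continuous although \<^term>\<open>ext i\<close> may be unbounded.\<close>

definition \<phi> :: "'i \<Rightarrow> 'a \<Rightarrow> real" where
  "\<phi> i x = max 0 (\<psi> i x - (\<Sum>j\<in>K. \<psi> j x) / (2 * card K))"

lemma psi_nonneg: "\<psi> i x \<ge> 0"
  by (simp add: \<psi>_def infdist_nonneg)

text \<open>Outside the case \<open>V i = UNIV\<close> this is the distance to a nonempty closed
  set. That case is separate because \<open>infdist\<close> to the empty set is 0 by
  convention.\<close>

lemma psi_pos: "\<psi> i x > 0 \<longleftrightarrow> x \<in> V i"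
proof (cases "V i = UNIV")
  case False
  then have "infdist x (- V i) = 0 \<longleftrightarrow> x \<notin> V i"
    using in_closed_iff_infdist_zero[of "- V i" x] open_V by auto
  then show ?thesis
    using False infdist_nonneg[of x "- V i"] by (auto simp: \<psi>_def less_le infdist_nonneg)
qed (simp add: \<psi>_def)

lemma continuous_psi: "continuous_on UNIV (\<psi> i)"
  unfolding \<psi>_def by (cases "V i = UNIV") (auto intro!: continuous_intros)

lemma psi_translate: "i \<in> K \<Longrightarrow> z \<in> integer_points \<Longrightarrow> \<psi> i (x + z) = \<psi> i x"
  unfolding \<psi>_def by (simp add: infdist_translation V_translate)

lemma sum_psi_pos: "(\<Sum>j\<in>K. \<psi> j x) > 0"
proof -
  obtain i where "i \<in> K" "x \<in> V i" using cover A_subset_V by blast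
  then show ?thesis
    using psi_nonneg psi_pos finite_K by (intro sum_pos2[of _ i]) auto
qed

lemma card_K_pos: "card K > 0"
  using finite_K cover by (auto simp: card_gt_0_iff)

lemma continuous_phi: "continuous_on UNIV (\<phi> i)"
  unfolding \<phi>_def using card_K_pos by (intro continuous_intros continuous_psi) auto

lemma phi_translate: "i \<in> K \<Longrightarrow> z \<in> integer_points \<Longrightarrow> \<phi> i (x + z) = \<phi> i x"
  unfolding \<phi>_def by (simp add: psi_translate)

lemma phi_nonneg: "\<phi> i x \<ge> 0"
  by (simp add: \<phi>_def)

lemma phi_nonzero_imp: "\<phi> i x \<noteq> 0 \<Longrightarrow> x \<in> V i"
proof (rule ccontr)
  assume "\<phi> i x \<noteq> 0" "x \<notin> V i"
  then have "\<psi> i x = 0"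
    using psi_pos[of i x] psi_nonneg[of i x] by linarith
  moreover have "(\<Sum>j\<in>K. \<psi> j x) / (2 * card K) \<ge> 0"
    by (simp add: sum_nonneg psi_nonneg)
  ultimately show False
    using \<open>\<phi> i x \<noteq> 0\<close> by (simp add: \<phi>_def)
qed

text \<open>The threshold in \<open>\<phi>\<close> is half the average of the
  \<open>\<psi> j\<close>. If none exceeded it, their positive sum would be at most half of
  itself.\<close>

lemma sum_phi_pos: "(\<Sum>j\<in>K. \<phi> j x) > 0"
proof (rule ccontr)
  assume "\<not> ?thesis"
  then have "(\<Sum>j\<in>K. \<phi> j x) = 0"
    using phi_nonneg by (meson sum_nonneg linorder_not_less order_antisym)
  then have "\<And>j. j \<in> K \<Longrightarrow> \<phi> j x = 0"
    using finite_K phi_nonneg by (simp add: sum_nonneg_eq_0_iff)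
  then have "\<And>j. j \<in> K \<Longrightarrow> \<psi> j x \<le> (\<Sum>j\<in>K. \<psi> j x) / (2 * card K)"
    by (fastforce simp: \<phi>_def max_def split: if_splits)
  then have "(\<Sum>j\<in>K. \<psi> j x) \<le> card K * ((\<Sum>j\<in>K. \<psi> j x) / (2 * card K))"
    by (rule sum_bounded_above)
  then show False
    using sum_psi_pos[of x] card_K_pos by simp
qed

lemma continuous_phi_ext:
  assumes i: "i \<in> K"
  shows "continuous_on UNIV (\<lambda>x. \<phi> i x *\<^sub>R ext i x)"
proof -
  have "isCont (\<lambda>x. \<phi> i x *\<^sub>R ext i x) x" for x
  proof (cases "x \<in> V i")
    case True
    have "isCont (\<lambda>y. \<phi> i y *\<^sub>R ext i x) x"
      using continuous_phi by (intro continuous_intros) (auto simp: continuous_on_eq_continuous_at)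
    moreover have "\<forall>\<^sub>F y in nhds x. \<phi> i y *\<^sub>R ext i y = \<phi> i y *\<^sub>R ext i x"
      using ext_locally_constant[OF True] by eventually_elim auto
    ultimately show ?thesis
      by (subst isCont_cong)
  next
    case False
    then have "\<psi> i x = 0" using psi_pos[of i x] psi_nonneg[of i x] by linarith
    then have "\<psi> i x < (\<Sum>j\<in>K. \<psi> j x) / (2 * card K)"
      using sum_psi_pos[of x] card_K_pos by simp
    moreover have "open {y. \<psi> i y < (\<Sum>j\<in>K. \<psi> j y) / (2 * card K)}"
      using card_K_pos by (intro open_Collect_less continuous_intros continuous_psi) auto
    ultimately have "\<forall>\<^sub>F y in nhds x. \<psi> i y < (\<Sum>j\<in>K. \<psi> j y) / (2 * card K)"
      by (metis (no_types, lifting) eventually_nhds mem_Collect_eq)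
    then have "\<forall>\<^sub>F y in nhds x. \<phi> i y *\<^sub>R ext i y = 0"
      by eventually_elim (auto simp: \<phi>_def)
    then show ?thesis
      by (subst isCont_cong[where g = "\<lambda>_. 0"]) auto
  qed
  then show ?thesis by (simp add: continuous_on_eq_continuous_at)
qed

section \<open>The averaged map and the dimension count\<close>

definition G :: "'a \<Rightarrow> 'a" where
  "G x = x - \<pi> x + (\<Sum>i\<in>K. \<phi> i x *\<^sub>R ext i x) /\<^sub>R (\<Sum>i\<in>K. \<phi> i x)"

lemma continuous_G: "continuous_on UNIV G"
  unfolding G_def using sum_phi_pos
  by (intro continuous_intros linear_continuous_on continuous_phi_ext continuous_phi)
     (auto simp: linear linear_conv_bounded_linear[symmetric] less_imp_neq[THEN not_sym])

text \<open>The weights are invariant and every value \<open>ext i x\<close> with nonzero weight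
  grows by \<open>\<pi> z\<close>; the term \<open>x - \<pi> x\<close> supplies the missing
  \<open>z - \<pi> z\<close>.\<close>

lemma G_translate:
  assumes z: "z \<in> integer_points"
  shows "G (x + z) = G x + z"
proof -
  have "\<phi> i (x + z) *\<^sub>R ext i (x + z) = \<phi> i x *\<^sub>R ext i x + \<phi> i x *\<^sub>R \<pi> z" if "i \<in> K" for i
    using that z phi_translate phi_nonzero_imp[of i x] V_translate_imp(2)
    by (cases "\<phi> i x = 0") (auto simp: scaleR_add_right)
  then have "(\<Sum>i\<in>K. \<phi> i (x + z) *\<^sub>R ext i (x + z))
      = (\<Sum>i\<in>K. \<phi> i x *\<^sub>R ext i x) + (\<Sum>i\<in>K. \<phi> i x) *\<^sub>R \<pi> z"
    by (simp add: sum.distrib scaleR_sum_left)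
  moreover have "(\<Sum>i\<in>K. \<phi> i (x + z)) = (\<Sum>i\<in>K. \<phi> i x)"
    using z by (intro sum.cong) (auto simp: phi_translate)
  ultimately show ?thesis
    using sum_phi_pos[of x] by (simp add: G_def scaleR_add_right linear_add[OF linear])
qed

text \<open>The displacement \<open>G x - x\<close> is periodic, so its bound on the compact unit
  cube holds everywhere.\<close>

lemma surj_G: "surj G"
proof -
  have "compact ((\<lambda>x. G x - x) ` cbox 0 One)"
    by (intro compact_continuous_image continuous_intros continuous_on_subset[OF continuous_G]) auto
  then obtain C where C: "\<And>x. x \<in> cbox 0 One \<Longrightarrow> norm (G x - x) \<le> C"
    by (meson bounded_iff compact_imp_bounded imageI)
  have "norm (G x - x) \<le> C" for x
  proof -
    obtain y z where "x = y + z" "y \<in> cbox 0 One" "z \<in> integer_points"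
      using integer_part .
    then show ?thesis
      using C[of y] G_translate[of z y] by simp
  qed
  then show ?thesis
    using continuous_G surj_if_bounded_displacement by blast
qed

text \<open>Otherwise, by \<open>nerve\<close>, at most \<open>DIM('a) - card B\<close> of the sets
  \<open>V i\<close> meet at any point. Every value of \<open>G\<close> then lies in a translate, by
  an integer point, of the span of \<open>B\<close> and a few integer vectors, fewer than
  \<open>DIM('a)\<close> in all. There are countably many such translates, so their union is
  negligible, contradicting \<open>surj_G\<close>.\<close>

theorem closures_meet:
  "\<exists>I\<subseteq>K. (\<Inter>i\<in>I. closure (A i)) \<noteq> {} \<and> DIM('a) < card I + card B"
proof (rule ccontr)
  assume "\<not> ?thesis"
  then have "card I + card B \<le> DIM('a)" if "I \<subseteq> K" "(\<Inter>i\<in>I. closure (A i)) \<noteq> {}" for I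
    using that by (meson not_less)
  then have small: "card {i\<in>K. x \<in> V i} + card B \<le> DIM('a)" for x
    using nerve[of x] by simp
  let ?D = "{D. finite D \<and> D \<subseteq> integer_points \<and> card (B \<union> D) < DIM('a)}"
  let ?\<F> = "(\<lambda>(w, D). (+) w ` span (B \<union> D)) ` (integer_points \<times> ?D)"
  have "countable ?D"
    by (rule countable_subset[OF _ countable_Collect_finite_subset[OF countable_integer_points]]) auto
  then have "countable ?\<F>"
    by (intro countable_image countable_SIGMA countable_integer_points)
  moreover have "negligible S" if "S \<in> ?\<F>" for S
    using that finite_B by (auto intro: negligible_translated_span)
  ultimately have "negligible (\<Union>?\<F>)"
    by (rule negligible_countable_Union) auto
  moreover have "G x \<in> \<Union>?\<F>" for x
  proof -
    define J where "J = {i\<in>K. \<phi> i x \<noteq> 0}"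
    define T where "T = (\<Sum>i\<in>K. \<phi> i x)"
    have T: "T > 0" using sum_phi_pos T_def by simp
    have J: "finite J" "J \<subseteq> {i\<in>K. x \<in> V i}"
      using phi_nonzero_imp finite_K by (auto simp: J_def)
    have TJ: "T = (\<Sum>i\<in>J. \<phi> i x)"
      unfolding T_def J_def by (intro sum.mono_neutral_right finite_K) auto
    obtain i0 where i0: "i0 \<in> J"
      using T TJ by (metis all_not_in_conv less_irrefl sum.empty)
    define w where "w = ext i0 x"
    \<comment> \<open>Taking differences against one chosen value \<open>w\<close> needs one vector
      fewer than \<open>J\<close> has elements; this makes the dimension strictly smaller than
      \<open>DIM('a)\<close>.\<close>
    define D where "D = (\<lambda>i. ext i x - w) ` (J - {i0})"
    have "card (B \<union> D) \<le> card B + card (J - {i0})"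
      unfolding D_def by (intro order_trans[OF card_Un_le] add_left_mono card_image_le) (use J in auto)
    also have "\<dots> < card B + card J"
      using J i0 by (intro add_strict_left_mono psubset_card_mono) auto
    also have "\<dots> \<le> DIM('a)"
      using small[of x] card_mono[OF _ J(2)] finite_K by (simp add: add.commute)
    finally have D: "D \<in> ?D"
      using J i0 unfolding D_def w_def by (auto intro!: integer_points_diff ext_integer)
    have "(\<Sum>i\<in>K. \<phi> i x *\<^sub>R ext i x) = (\<Sum>i\<in>J. \<phi> i x *\<^sub>R ext i x)"
      unfolding J_def by (intro sum.mono_neutral_right finite_K) auto
    also have "\<dots> = (\<Sum>i\<in>J. \<phi> i x *\<^sub>R (ext i x - w)) + T *\<^sub>R w"
      by (simp add: TJ scaleR_diff_right sum_subtractf scaleR_sum_left)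
    finally have "G x = w + ((x - \<pi> x) + (\<Sum>i\<in>J. \<phi> i x *\<^sub>R (ext i x - w)) /\<^sub>R T)"
      using T by (simp add: G_def T_def[symmetric] scaleR_add_right)
    moreover have "ext i x - w \<in> span (B \<union> D)" if "i \<in> J" for i
      using that by (cases "i = i0") (auto simp: w_def D_def span_zero intro: span_base)
    then have "(x - \<pi> x) + (\<Sum>i\<in>J. \<phi> i x *\<^sub>R (ext i x - w)) /\<^sub>R T \<in> span (B \<union> D)"
      using diff_span[of x] span_mono[of B "B \<union> D"]
      by (intro span_add span_scale span_sum) auto
    moreover have "w \<in> integer_points"
      using J i0 ext_integer by (auto simp: w_def)
    ultimately show ?thesis
      using D by blast
  qed
  then have "range G \<subseteq> \<Union>?\<F>"
    by blast
  then have "\<Union>?\<F> = UNIV"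
    unfolding surj_G by (rule top.extremum_uniqueI)
  ultimately show False
    by (metis non_negligible_UNIV)
qed

end

section \<open>Variation of the logarithm and continuity in the path space\<close>

definition log_variation :: "(real \<Rightarrow> complex) \<Rightarrow> complex" where
  "log_variation c = (THE w. \<exists>\<theta>. continuous_on {0..1} \<theta> \<and> (\<forall>t\<in>{0..1}. c t = exp (\<theta> t)) \<and> w = \<theta> 1 - \<theta> 0)"

text \<open>Two continuous logarithms of one path differ by a continuous function with values in the
  discrete kernel of \<open>exp\<close>, hence by a constant on the interval.\<close>

lemma log_variation_eq:
  assumes \<theta>: "continuous_on {0..1} \<theta>" and c: "\<And>t. t \<in> {0..1} \<Longrightarrow> c t = exp (\<theta> t)"
  shows "log_variation c = \<theta> 1 - \<theta> 0"
  unfolding log_variation_def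
proof (rule the_equality)
  show "\<exists>\<theta>'. continuous_on {0..1} \<theta>' \<and> (\<forall>t\<in>{0..1}. c t = exp (\<theta>' t)) \<and> \<theta> 1 - \<theta> 0 = \<theta>' 1 - \<theta>' 0"
    using assms by blast
next
  fix w
  assume "\<exists>\<theta>'. continuous_on {0..1} \<theta>' \<and> (\<forall>t\<in>{0..1}. c t = exp (\<theta>' t)) \<and> w = \<theta>' 1 - \<theta>' 0"
  then obtain \<theta>' where \<theta>': "continuous_on {0..1} \<theta>'" "\<And>t. t \<in> {0..1} \<Longrightarrow> c t = exp (\<theta>' t)" "w = \<theta>' 1 - \<theta>' 0"
    by blast
  have eq: "exp (\<theta> t - \<theta>' t) = 1" if "t \<in> {0..1}" for t
    using c[OF that] \<theta>'(2)[OF that] by (simp add: exp_diff)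
  have "(\<lambda>t. \<theta> t - \<theta>' t) constant_on {0..1}"
  proof (rule continuous_discrete_range_constant)
    show "connected {0..1::real}" by simp
    show "continuous_on {0..1} (\<lambda>t. \<theta> t - \<theta>' t)"
      using \<theta> \<theta>' by (intro continuous_intros)
    show "\<exists>e>0. \<forall>y. y \<in> {0..1} \<and> \<theta> y - \<theta>' y \<noteq> \<theta> x - \<theta>' x
        \<longrightarrow> e \<le> cmod ((\<theta> y - \<theta>' y) - (\<theta> x - \<theta>' x))" if x: "x \<in> {0..1}" for x
    \<comment> \<open>Distinct elements of the kernel of \<open>exp\<close> are at least
      \<open>2 * pi\<close> apart, so 1 is a safe separation.\<close>
    proof (intro exI[of _ 1] conjI allI impI)
      fix y assume y: "y \<in> {0..1} \<and> \<theta> y - \<theta>' y \<noteq> \<theta> x - \<theta>' x"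
      show "1 \<le> cmod ((\<theta> y - \<theta>' y) - (\<theta> x - \<theta>' x))"
      proof (rule ccontr)
        define a b where "a = \<theta> y - \<theta>' y" and "b = \<theta> x - \<theta>' x"
        assume "\<not> ?thesis"
        then have "cmod (a - b) < 2 * pi"
          using pi_gt3 by (simp add: a_def b_def)
        then have "\<bar>Im a - Im b\<bar> < 2 * pi"
          using abs_Im_le_cmod[of "a - b"] by simp
        moreover have "exp a = exp b"
          using eq x y by (simp add: a_def b_def)
        ultimately have "a = b"
          by (rule exp_complex_eqI)
        then show False using y by (simp add: a_def b_def)
      qed
    qed simp
  qed
  then obtain k where k: "\<And>t. t \<in> {0..1} \<Longrightarrow> \<theta> t - \<theta>' t = k"
    by (auto simp: constant_on_def)
  have "\<theta> 1 - \<theta>' 1 = \<theta> 0 - \<theta>' 0"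
    using k[of 0] k[of 1] by simp
  then show "w = \<theta> 1 - \<theta> 0"
    using \<theta>'(3) by algebra
qed

lemma log_variation_lift:
  assumes "continuous_on {0..1} c" "\<And>t. t \<in> {0..1} \<Longrightarrow> c t \<noteq> 0"
  obtains \<theta> where "continuous_on {0..1} \<theta>" "\<And>t. t \<in> {0..1} \<Longrightarrow> c t = exp (\<theta> t)"
    "log_variation c = \<theta> 1 - \<theta> 0"
proof -
  have "contractible {0..1::real}"
    by (intro convex_imp_contractible) simp
  then obtain \<theta> where "continuous_on {0..1} \<theta>" "\<And>t. t \<in> {0..1} \<Longrightarrow> c t = exp (\<theta> t)"
    using continuous_logarithm_on_contractible assms by metis
  then show ?thesis
    using that log_variation_eq by metis
qed

lemma exp_log_variation:
  assumes "continuous_on {0..1} c" "\<And>t. t \<in> {0..1} \<Longrightarrow> c t \<noteq> 0"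
  shows "exp (log_variation c) = c 1 / c 0"
  using log_variation_lift[OF assms] by (metis atLeastAtMost_iff exp_diff order_refl zero_le_one)

lemma divide_notin_nonpos_Reals:
  fixes z w :: complex
  assumes "cmod (z - w) < cmod w"
  shows "z / w \<notin> \<real>\<^sub>\<le>\<^sub>0"
proof -
  have w: "w \<noteq> 0" using assms by auto
  have "cmod (z / w - 1) < 1"
    using assms w norm_divide[of "z - w" w] by (simp add: diff_divide_distrib)
  then have "Re (z / w) > 0"
    using abs_Re_le_cmod[of "z / w - 1"] by simp
  then show ?thesis
    by (auto simp: complex_nonpos_Reals_iff)
qed

text \<open>Closeness keeps \<open>d t / c t\<close> off the slit of \<open>Ln\<close>, so adding
  \<open>Ln (d t / c t)\<close> to a logarithm of \<open>c\<close> gives a logarithm of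
  \<open>d\<close>. The change of the variation is then read off at the end points.\<close>

lemma log_variation_near:
  assumes c: "continuous_on {0..1} c" and d: "continuous_on {0..1} d"
    and near: "\<And>t. t \<in> {0..1} \<Longrightarrow> cmod (d t - c t) < cmod (c t)"
  shows "log_variation d = log_variation c + Ln (d 1 / c 1) - Ln (d 0 / c 0)"
proof -
  have nz: "c t \<noteq> 0" "d t / c t \<notin> \<real>\<^sub>\<le>\<^sub>0" "d t / c t \<noteq> 0" if "t \<in> {0..1}" for t
    using near[OF that] divide_notin_nonpos_Reals by auto
  obtain \<theta> where \<theta>: "continuous_on {0..1} \<theta>" "\<And>t. t \<in> {0..1} \<Longrightarrow> c t = exp (\<theta> t)"
    "log_variation c = \<theta> 1 - \<theta> 0"
    using log_variation_lift[OF c nz(1)] by blast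
  have "log_variation d = (\<theta> 1 + Ln (d 1 / c 1)) - (\<theta> 0 + Ln (d 0 / c 0))"
  proof (rule log_variation_eq)
    show "continuous_on {0..1} (\<lambda>t. \<theta> t + Ln (d t / c t))"
      using nz by (intro continuous_intros \<theta> c d) auto
    show "d t = exp (\<theta> t + Ln (d t / c t))" if "t \<in> {0..1}" for t
      using nz[OF that] \<theta>(2)[OF that] by (simp add: exp_add)
  qed
  then show ?thesis
    using \<theta>(3) by simp
qed

text \<open>Compactness of the interval bounds \<open>c x\<close> away from 0 and makes nearby paths
  uniformly close to it. Near \<open>x\<close>, \<open>log_variation_near\<close> thus expresses the
  variation through the values at times 0 and 1 alone.\<close>

lemma continuous_log_variation:
  fixes c :: "'a::metric_space \<Rightarrow> real \<Rightarrow> complex"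
  assumes cont: "continuous_on (S \<times> {0..1}) (\<lambda>(x, t). c x t)"
    and nz: "\<And>x t. x \<in> S \<Longrightarrow> t \<in> {0..1} \<Longrightarrow> c x t \<noteq> 0"
  shows "continuous_on S (\<lambda>x. log_variation (c x))"
  unfolding continuous_on_eq_continuous_within
proof
  fix x assume x: "x \<in> S"
  have path: "continuous_on {0..1} (c y)" if "y \<in> S" for y
    using continuous_on_compose2[OF cont, of "{0..1}" "Pair y"] that
      continuous_on_Pair[OF continuous_on_const continuous_on_id]
    by (force simp: image_subset_iff)
  have eval: "continuous_on S (\<lambda>y. c y t)" if "t \<in> {0..1}" for t
    using continuous_on_compose2[OF cont, of S "\<lambda>y. (y, t)"] that
      continuous_on_Pair[OF continuous_on_id continuous_on_const]
    by (force simp: image_subset_iff)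
  obtain e where e: "e > 0" "\<And>t. t \<in> {0..1} \<Longrightarrow> e \<le> cmod (c x t)"
  proof -
    have "continuous_on {0..1} (\<lambda>t. cmod (c x t))"
      using path[OF x] by (intro continuous_intros)
    then have "\<exists>m\<in>{0..1}. \<forall>t\<in>{0..1}. cmod (c x m) \<le> cmod (c x t)"
      by (intro continuous_attains_inf) auto
    then obtain m where m: "m \<in> {0..1}" "\<And>t. t \<in> {0..1} \<Longrightarrow> cmod (c x m) \<le> cmod (c x t)"
      by blast
    show ?thesis
      using that[of "cmod (c x m)"] m nz[OF x] by auto
  qed
  have "e / 2 > 0" using e(1) by simp
  from continuous_on_prod_compactE[OF cont compact_Icc x this]
  obtain X0 where X0: "x \<in> X0" "open X0"
    "\<forall>y\<in>X0 \<inter> S. \<forall>t\<in>{0..1}. dist (c y t) (c x t) \<le> e / 2"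
    by (metis (no_types, lifting) case_prod_conv)
  have near: "cmod (c y t - c x t) < cmod (c x t)" if "y \<in> X0 \<inter> S" "t \<in> {0..1}" for y t
    
  proof -
    have "dist (c y t) (c x t) \<le> e / 2" using X0(3) that by blast
    then show ?thesis
      using e(1) e(2)[OF that(2)] by (simp add: dist_norm)
  qed
  have 1: "log_variation (c y) = log_variation (c x) + Ln (c y 1 / c x 1) - Ln (c y 0 / c x 0)"
    if "y \<in> X0 \<inter> S" for y
    using that near path x by (intro log_variation_near) auto
  have "continuous_on (X0 \<inter> S) (\<lambda>y. log_variation (c x) + Ln (c y 1 / c x 1) - Ln (c y 0 / c x 0))"
    using near nz x
    by (intro continuous_intros continuous_on_subset[OF eval] divide_notin_nonpos_Reals) auto
  then have "continuous_on (X0 \<inter> S) (\<lambda>y. log_variation (c y))"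
    by (rule continuous_on_eq) (simp add: 1)
  then have "continuous (at x within (X0 \<inter> S)) (\<lambda>y. log_variation (c y))"
    using X0(1) x by (simp add: continuous_on_eq_continuous_within)
  then show "continuous (at x within S) (\<lambda>y. log_variation (c y))"
    using at_within_nhd[OF X0(1,2), of S "X0 \<inter> S"] by (simp add: continuous_within Int_ac)
qed

section \<open>Joint continuity and the compact-open topology\<close>

lemma continuous_path_space_imp_joint:
  fixes X :: "'b::metric_space set" and F :: "'a::metric_space set"
  assumes s: "continuous_map (top_of_set F) (path_space (top_of_set X)) s"
  shows "continuous_on (F \<times> {0..1}) (\<lambda>(p, t). s p t)"
  unfolding continuous_on_def
proof (intro ballI, unfold tendsto_def, intro allI impI)
  fix q :: "'a \<times> real" and U :: "'b set"
  assume q: "q \<in> F \<times> {0..1}" and U: "open U" "(case q of (p, t) \<Rightarrow> s p t) \<in> U"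
  obtain p t where pt: "q = (p, t)" "p \<in> F" "t \<in> {0..1}" using q by auto
  have "s p \<in> paths (top_of_set X)"
    using continuous_map_image_subset_topspace[OF s] pt by auto
  then have sp: "continuous_on {0..1} (s p)"
    by (simp add: paths_def pathin_def continuous_map_in_subtopology)
  have "openin (top_of_set {0..1}) ({0..1} \<inter> s p -` U)"
    using continuous_openin_preimage_gen[OF sp U(1)] .
  then obtain e where e: "e > 0" "\<And>t'. t' \<in> {0..1} \<Longrightarrow> dist t' t \<le> e \<Longrightarrow> s p t' \<in> U"
  proof -
    have "t \<in> {0..1} \<inter> s p -` U" using U(2) pt by simp
    then obtain e where "e > 0" "cball t e \<inter> {0..1} \<subseteq> {0..1} \<inter> s p -` U"
      using \<open>openin (top_of_set {0..1}) ({0..1} \<inter> s p -` U)\<close> unfolding openin_contains_cball by blast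
    then show ?thesis
      by (intro that[of e]) (auto simp: dist_commute subset_iff)
  qed
  \<comment> \<open>\<open>L\<close> is a compact neighbourhood of \<open>t\<close> in the interval
    that \<open>s p\<close> maps into \<open>U\<close>. The corresponding subbasic set
    \<open>W\<close> controls all times in \<open>L\<close> at once for nearby points of
    \<open>F\<close>.\<close>
  define L where "L = cball t e \<inter> {0..1}"
  define W where "W = {\<gamma> \<in> paths (top_of_set X). \<gamma> ` L \<subseteq> X \<inter> U}"
  have "openin (path_space (top_of_set X)) W"
    unfolding path_space_def W_def
  proof (rule topology_generated_by_Basis)
    have "compact L" "L \<subseteq> {0..1}" "openin (top_of_set X) (X \<inter> U)"
      using U(1) by (auto simp: L_def compact_Int openin_open_Int)
    then show "{\<gamma> \<in> paths (top_of_set X). \<gamma> ` L \<subseteq> X \<inter> U} \<in>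
      {{\<gamma> \<in> paths (top_of_set X). \<gamma> ` K \<subseteq> U} |K U. compact K \<and> K \<subseteq> {0..1} \<and> openin (top_of_set X) U}"
      by blast
  qed
  then have "openin (top_of_set F) {p \<in> F. s p \<in> W}"
    using openin_continuous_map_preimage[OF s] by simp
  moreover have "p \<in> {p \<in> F. s p \<in> W}"
    using \<open>s p \<in> paths _\<close> e(2) pt
    by (auto simp: W_def L_def paths_def pathin_def continuous_map_in_subtopology dist_commute)
  ultimately obtain Q where Q: "open Q" "p \<in> Q" "F \<inter> Q \<subseteq> {p \<in> F. s p \<in> W}"
    by (auto simp: openin_open)
  have "\<forall>\<^sub>F r in at q within F \<times> {0..1}. r \<in> Q \<times> ball t e"
    unfolding eventually_at_topological
    using Q(1,2) e(1) pt by (intro exI[of _ "Q \<times> ball t e"]) (auto intro: open_Times)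
  moreover have "\<forall>\<^sub>F r in at q within F \<times> {0..1}. r \<in> F \<times> {0..1}"
    by (auto simp: eventually_at_topological)
  ultimately show "\<forall>\<^sub>F r in at q within F \<times> {0..1}. (case r of (p, t) \<Rightarrow> s p t) \<in> U"
  proof eventually_elim
    case (elim r)
    then obtain p' t' where r: "r = (p', t')" "p' \<in> F \<inter> Q" "t' \<in> L"
      by (auto simp: L_def)
    then have "s p' ` L \<subseteq> U"
      using Q(3) by (auto simp: W_def)
    then show ?case
      using r by auto
  qed
qed

text \<open>The preimage of a subbasic set consists of the \<open>p\<close> for which
  \<open>{p} \<times> K\<close> lies in an open set; the tube lemma for the compact \<open>K\<close>
  makes this an open condition.\<close>

lemma joint_imp_continuous_path_space:
  fixes X :: "'b::metric_space set" and F :: "'a::metric_space set"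
  assumes h: "continuous_on (F \<times> {0..1}) (\<lambda>(p, t). h p t)"
    and X: "\<And>p t. p \<in> F \<Longrightarrow> t \<in> {0..1} \<Longrightarrow> h p t \<in> X"
  shows "continuous_map (top_of_set F) (path_space (top_of_set X)) (\<lambda>p. restrict (h p) {0..1})"
  unfolding path_space_def
proof (rule continuous_on_generated_topo)
  have path: "continuous_on {0..1} (h p)" if "p \<in> F" for p
    using continuous_on_compose2[OF h, of "{0..1}" "Pair p"] that
      continuous_on_Pair[OF continuous_on_const continuous_on_id]
    by (force simp: image_subset_iff)
  have paths: "restrict (h p) {0..1} \<in> paths (top_of_set X)" if "p \<in> F" for p
  proof -
    have "continuous_on {0..1} (restrict (h p) {0..1})"
      using path[OF that] by (rule continuous_on_eq) simp
    then show ?thesis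
      using X[OF that] by (auto simp: paths_def pathin_def continuous_map_in_subtopology)
  qed
  show "(\<lambda>p. restrict (h p) {0..1}) ` topspace (top_of_set F)
     \<subseteq> \<Union> {{\<gamma> \<in> paths (top_of_set X). \<gamma> ` K \<subseteq> U} |K U. compact K \<and> K \<subseteq> {0..1} \<and> openin (top_of_set X) U}"
    using paths topspace_path_space[of "top_of_set X"]
    unfolding path_space_def topology_generated_by_topspace by auto
  fix W assume "W \<in> {{\<gamma> \<in> paths (top_of_set X). \<gamma> ` K \<subseteq> U} |K U.
        compact K \<and> K \<subseteq> {0..1} \<and> openin (top_of_set X) U}"
  then obtain K U where W: "W = {\<gamma> \<in> paths (top_of_set X). \<gamma> ` K \<subseteq> U}" "compact K" "K \<subseteq> {0..1}"
    "openin (top_of_set X) U" by blast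
  obtain U' where U': "open U'" "U = X \<inter> U'" using W(4) by (auto simp: openin_open)
  have hK: "continuous_on (F \<times> K) (\<lambda>(p, t). h p t)"
    using h by (rule continuous_on_subset) (use W in auto)
  have "openin (top_of_set (F \<times> K)) (F \<times> K \<inter> (\<lambda>(p, t). h p t) -` U')"
    using continuous_openin_preimage_gen[OF hK U'(1)] .
  then obtain O' where O': "open O'" "F \<times> K \<inter> (\<lambda>(p, t). h p t) -` U' = F \<times> K \<inter> O'"
    by (auto simp: openin_open)
  have eq: "(\<lambda>p. restrict (h p) {0..1}) -` W \<inter> F = {p \<in> F. {p} \<times> K \<subseteq> O'}"
  proof -
    have "restrict (h p) {0..1} \<in> W \<longleftrightarrow> {p} \<times> K \<subseteq> O'" if p: "p \<in> F" for p
    proof -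
      have "restrict (h p) {0..1} ` K = h p ` K"
        using W(3) by (intro image_cong) auto
      then have "restrict (h p) {0..1} \<in> W \<longleftrightarrow> (\<forall>t\<in>K. h p t \<in> U)"
        using paths[OF p] by (auto simp: W(1))
      also have "\<dots> \<longleftrightarrow> (\<forall>t\<in>K. h p t \<in> U')"
        using X[OF p] W(3) U'(2) by blast
      also have "\<dots> \<longleftrightarrow> (\<forall>t\<in>K. (p, t) \<in> O')"
      proof (rule ball_cong[OF refl])
        fix t assume "t \<in> K"
        then have "(p, t) \<in> F \<times> K" using p by blast
        then show "h p t \<in> U' \<longleftrightarrow> (p, t) \<in> O'"
          using O'(2) by (metis (mono_tags, lifting) IntD2 IntI case_prod_conv vimageD vimageI2)
      qed
      finally show ?thesis by blast
    qed
    then show ?thesis by blast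
  qed
  have "\<exists>Q. open Q \<and> p \<in> Q \<and> F \<inter> Q \<subseteq> {p \<in> F. {p} \<times> K \<subseteq> O'}" if p: "p \<in> F" "{p} \<times> K \<subseteq> O'" for p
  proof -
    obtain Q where "open Q" "p \<in> Q" "Q \<times> K \<subseteq> O'"
      using Elementary_Topology.tube_lemma[OF W(2) O'(1) p(2)] by blast
    then show ?thesis by blast
  qed
  then have "openin (top_of_set F) {p \<in> F. {p} \<times> K \<subseteq> O'}"
    by (subst openin_subopen) (metis (no_types, lifting) IntI mem_Collect_eq openin_open_Int)
  then show "openin (top_of_set F) ((\<lambda>p. restrict (h p) {0..1}) -` W \<inter> topspace (top_of_set F))"
    unfolding topspace_euclidean_subtopology eq .
qed

section \<open>The lower bound\<close>

definition planar :: "real ^ 2 \<Rightarrow> complex" where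
  "planar v = Complex (v $ 1) (v $ 2)"

definition config :: "('n \<Rightarrow> complex) \<Rightarrow> (real ^ 2) ^ 'n" where
  "config f = (\<chi> a. vector [Re (f a), Im (f a)])"

lemma planar_config [simp]: "planar (config f $ a) = f a"
  by (simp add: planar_def config_def vector_2)

lemma config_planar [simp]: "config (\<lambda>a. planar (x $ a)) = x"
  by (simp add: planar_def config_def vec_eq_iff forall_2 vector_2)

lemma planar_eq_iff [simp]: "planar v = planar w \<longleftrightarrow> v = w"
  by (simp add: planar_def vec_eq_iff forall_2)

lemma planar_alt: "planar v = complex_of_real (v $ 1) + \<i> * complex_of_real (v $ 2)"
  by (simp add: planar_def complex_eq_iff)

lemma continuous_on_planar [continuous_intros]:
  "continuous_on S g \<Longrightarrow> continuous_on S (\<lambda>x. planar (g x))"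
  unfolding planar_alt by (intro continuous_intros)

lemma continuous_on_config [continuous_intros]:
  assumes "\<And>a. continuous_on S (\<lambda>x. g x a)"
  shows "continuous_on S (\<lambda>x. config (g x))"
proof -
  have eq: "config f = (\<chi> a b. if b = 1 then Re (f a) else Im (f a))" for f :: "'m::finite \<Rightarrow> complex"
    by (simp add: config_def vec_eq_iff forall_2 vector_2)
  have "continuous_on S (\<lambda>x. if b = 1 then Re (g x a) else Im (g x a))" for a and b :: 2
    by (cases "b = 1") (auto intro!: continuous_intros assms)
  then show ?thesis
    unfolding eq by (intro continuous_on_vec_lambda)
qed

lemma config_in_config_space: "config f \<in> config_space \<longleftrightarrow> inj f"
proof -
  have "config f $ i = config f $ j \<longleftrightarrow> f i = f j" for i j
    using planar_eq_iff[of "config f $ i" "config f $ j"] by simp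
  then show ?thesis
    by (auto simp: config_space_def inj_def)
qed

section \<open>Points on concentric circles\<close>

definition torus :: "('n \<Rightarrow> nat) \<Rightarrow> real ^ 'n \<Rightarrow> 'n \<Rightarrow> complex" where
  "torus \<rho> t j = of_nat (\<rho> j) * exp (2 * pi * \<i> * t $ j)"

text \<open>Since \<^term>\<open>\<rho> i < \<rho> j\<close>, the argument of \<open>Ln\<close> lies in the right half plane, so this is a
  continuous logarithm of \<^term>\<open>torus \<rho> t j - torus \<rho> t i\<close> on the whole universal cover of the torus.\<close>

definition log_diff :: "('n \<Rightarrow> nat) \<Rightarrow> real ^ 'n \<Rightarrow> 'n \<Rightarrow> 'n \<Rightarrow> complex" where
  "log_diff \<rho> t i j = ln (real (\<rho> j)) + 2 * pi * \<i> * t $ j + Ln (1 - torus \<rho> t i / torus \<rho> t j)"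

lemma norm_torus [simp]: "cmod (torus \<rho> t j) = \<rho> j"
  by (simp add: torus_def norm_mult)

lemma torus_nonzero: "\<rho> i < \<rho> j \<Longrightarrow> torus \<rho> t j \<noteq> 0"
  by (simp add: torus_def)

lemma inj_torus: "inj \<rho> \<Longrightarrow> inj (torus \<rho> t)"
  by (metis (mono_tags, lifting) injD injI norm_torus of_nat_eq_iff)

lemma continuous_torus: "continuous_on S (\<lambda>t. torus \<rho> t j)"
  unfolding torus_def by (intro continuous_intros)

lemma torus_translate:
  assumes "v $ j \<in> \<int>"
  shows "torus \<rho> (t + v) j = torus \<rho> t j"
proof -
  obtain m :: int where "v $ j = of_int m"
    using assms by (auto elim: Ints_cases)
  then have "exp (2 * pi * \<i> * complex_of_real (v $ j)) = 1"
    using exp_integer_2pi[of "of_int m"]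
    by (simp add:  mult_ac)
  then show ?thesis
    by (simp add: torus_def distrib_left exp_add)
qed

lemma log_diff_slit:
  assumes "\<rho> i < \<rho> j"
  shows "1 - torus \<rho> t i / torus \<rho> t j \<notin> \<real>\<^sub>\<le>\<^sub>0"
proof -
  have "(torus \<rho> t j - torus \<rho> t i) / torus \<rho> t j \<notin> \<real>\<^sub>\<le>\<^sub>0"
    by (rule divide_notin_nonpos_Reals) (use assms in simp)
  then show ?thesis
    using torus_nonzero[OF assms] by (simp add: diff_divide_distrib)
qed

lemma exp_log_diff:
  assumes "\<rho> i < \<rho> j"
  shows "exp (log_diff \<rho> t i j) = torus \<rho> t j - torus \<rho> t i"
proof -
  have nz: "torus \<rho> t j \<noteq> 0" "1 - torus \<rho> t i / torus \<rho> t j \<noteq> 0"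
    using torus_nonzero[OF assms] log_diff_slit[OF assms, of t] by auto
  have "exp (complex_of_real (ln (real (\<rho> j)))) = of_nat (\<rho> j)"
    using assms exp_of_real[of "ln (real (\<rho> j))", where 'a = complex] by simp
  then have "exp (log_diff \<rho> t i j) = torus \<rho> t j * (1 - torus \<rho> t i / torus \<rho> t j)"
    using nz by (simp add: log_diff_def exp_add torus_def)
  then show ?thesis
    using nz by (simp add: algebra_simps)
qed

lemma continuous_log_diff:
  assumes "\<rho> i < \<rho> j"
  shows "continuous_on S (\<lambda>t. log_diff \<rho> t i j)"
proof -
  have nz: "\<forall>t\<in>S. torus \<rho> t j \<noteq> 0"
    using torus_nonzero[OF assms] by blast
  show ?thesis
    unfolding log_diff_def
    by (intro continuous_intros continuous_torus log_diff_slit[OF assms] nz)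
qed

lemma log_diff_translate:
  assumes "v $ i \<in> \<int>" "v $ j \<in> \<int>"
  shows "log_diff \<rho> (t + v) i j = log_diff \<rho> t i j + 2 * pi * \<i> * v $ j"
  using assms by (simp add: log_diff_def torus_translate algebra_simps)

lemma mem_integer_points_prod:
  fixes t u :: "real ^ 'n"
  shows "(t, u) \<in> integer_points \<longleftrightarrow> (\<forall>j. t $ j \<in> \<int>) \<and> (\<forall>j. u $ j \<in> \<int>)"
proof
  assume int: "(t, u) \<in> integer_points"
  have "(axis j 1, 0) \<in> (Basis :: ((real ^ 'n) \<times> (real ^ 'n)) set)"
    "(0, axis j 1) \<in> (Basis :: ((real ^ 'n) \<times> (real ^ 'n)) set)" for j
    by (auto simp: Basis_prod_def Basis_vec_def)
  then have "(t, u) \<bullet> (axis j 1, 0) \<in> \<int>" "(t, u) \<bullet> (0, axis j 1) \<in> \<int>" for j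
    using int unfolding integer_points_def by blast+
  then show "(\<forall>j. t $ j \<in> \<int>) \<and> (\<forall>j. u $ j \<in> \<int>)"
    by (simp add: inner_axis)
qed (auto simp: integer_points_def Basis_prod_def Basis_vec_def inner_axis)

text \<open>Two points with integer coordinates at distance less than 1 coincide.\<close>

lemma integer_valued_locally_constant:
  fixes g :: "'a::metric_space \<Rightarrow> 'b::euclidean_space"
  assumes g: "continuous_on A g" and int: "\<And>x. x \<in> A \<Longrightarrow> g x \<in> integer_points" and x: "x \<in> A"
  shows "\<exists>r>0. \<forall>y\<in>A. dist x y < r \<longrightarrow> g y = g x"
proof -
  obtain r where r: "r > 0" "\<And>y. y \<in> A \<Longrightarrow> dist y x < r \<Longrightarrow> dist (g y) (g x) < 1"
    using g x unfolding continuous_on_iff by (metis zero_less_one)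
  have "g y = g x" if y: "y \<in> A" "dist x y < r" for y
  proof (rule euclidean_eqI)
    fix b :: 'b assume b: "b \<in> Basis"
    have "\<bar>(g y - g x) \<bullet> b\<bar> < 1"
      using Basis_le_norm[OF b, of "g y - g x"] r(2)[of y] y by (simp add: dist_norm dist_commute)
    moreover have "(g y - g x) \<bullet> b \<in> \<int>"
      using integer_points_diff[OF int[OF y(1)] int[OF x]] b by (simp add: integer_points_def)
    ultimately show "g y \<bullet> b = g x \<bullet> b"
      using Ints_nonzero_abs_less1 by (fastforce simp: inner_diff_left)
  qed
  then show ?thesis
    using r(1) by blast
qed

theorem motion_planner_lower_bound:
  fixes F :: "nat \<Rightarrow> (((real ^ 2) ^ 'n) \<times> ((real ^ 2) ^ 'n)) set"
  assumes n: "CARD('n) \<ge> 2" and mp: "motion_planner config_space k F s"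
  shows "\<exists>I\<subseteq>{1..k}. (\<Inter>i\<in>I. top_of_set (config_space \<times> config_space) closure_of F i) \<noteq> {} \<and>
    2 * CARD('n) - 2 \<le> card I"
proof -
  let ?X = "config_space :: ((real ^ 2) ^ 'n) set"
  obtain h where h: "bij_betw h (UNIV :: 'n set) {0..<CARD('n)}"
    using ex_bij_betw_finite_nat[OF finite] by blast
  have "0 \<in> h ` UNIV" "CARD('n) - 1 \<in> h ` UNIV"
    using h n by (auto simp: bij_betw_def)
  then obtain a0 a1 where ends: "h a0 = 0" "h a1 = CARD('n) - 1"
    by (metis imageE)
  have inj: "inj h" and h_less: "h j < CARD('n)" for j
    using h by (auto simp: bij_betw_def)
  \<comment> \<open>\<open>g\<close> reverses the radial order: \<open>a0\<close> is central at the
    start and outermost at the end of a motion, \<open>a1\<close> the other way round.\<close>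
  define g where "g j = CARD('n) - 1 - h j" for j
  have "inj g"
    using inj h_less unfolding g_def inj_def by (metis Suc_pred' diff_diff_cancel less_Suc_eq_le zero_less_card_finite)
  have "a0 \<noteq> a1" using ends n by auto
  have h_pos: "h a0 < h j" if "j \<noteq> a0" for j
    using that ends inj by (metis injD neq0_conv)
  have h_max: "h j < h a1" if "j \<noteq> a1" for j
    using that ends inj h_less[of j] by (metis Suc_pred' injD less_SucE zero_less_card_finite)
  have g_less: "g j < g i" if "h i < h j" for i j
    using that h_less[of j] by (simp add: g_def)
  \<comment> \<open>Adding one integer to all angles at both ends changes no winding number, so the
    end angle of \<open>a0\<close> is frozen at 0.\<close>
  define drop_o where "drop_o u = (\<chi> j. if j = a0 then 0 else u $ j)" for u :: "real ^ 'n"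
  define e where "e = (\<lambda>(t, u). (config (torus h t), config (torus g (drop_o u))))"
  define A where "A i = {x. e x \<in> F i}" for i
  define c where "c i p q x \<tau> = planar (s i (e x) \<tau> $ q) - planar (s i (e x) \<tau> $ p)" for i p q x \<tau>
  \<comment> \<open>When \<open>h p < h q\<close>, point \<open>p\<close> is the inner one at the
    start and the outer one at the end, so the end difference is minus the exponential of the second
    \<open>log_diff\<close>. Subtracting \<open>pi\<close> accounts for this sign and makes the
    quotient an integer.\<close>
  define N where "N i p q x = (Im (log_variation (c i p q x) + log_diff h (fst x) p q
      - log_diff g (drop_o (snd x)) q p) - pi) / (2 * pi)" for i p q x
  \<comment> \<open>By \<open>N_add\<close> below, a lattice vector \<open>(v, v')\<close> changes
    \<open>N i p q\<close> by \<open>v $ q - drop_o v' $ p\<close>. For \<open>p = a0\<close> only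
    \<open>v $ q\<close> remains; in the second component \<open>v $ a1\<close> cancels and
    \<open>v' $ j\<close> remains.\<close>
  define f where "f i x = ((\<chi> j. if j = a0 then 0 else N i a0 j x) :: real ^ 'n,
     (\<chi> j. if j = a0 \<or> j = a1 then 0 else N i a0 a1 x - N i j a1 x) :: real ^ 'n)" for i x
  define \<pi> where "\<pi> = (\<lambda>(t, u). (drop_o t, (\<chi> j. if j = a0 \<or> j = a1 then 0 else u $ j) :: real ^ 'n))"
  define B where "B = {(axis a0 1, 0), (0, axis a0 1), (0, axis a1 1) :: (real ^ 'n) \<times> (real ^ 'n)}"
  have e_in: "e x \<in> ?X \<times> ?X" for x
    using inj_torus[OF inj] inj_torus[OF \<open>inj g\<close>]
    by (simp add: e_def case_prod_unfold config_in_config_space)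
  have cont_drop: "continuous_on S drop_o" for S
  proof -
    have "continuous_on S (\<lambda>u. if j = a0 then 0 else u $ j)" for j
      by (cases "j = a0") (auto intro!: continuous_intros)
    then show ?thesis unfolding drop_o_def by (rule continuous_on_vec_lambda)
  qed
  have cont_e: "continuous_on S e" for S
    unfolding e_def case_prod_unfold
    by (intro continuous_intros continuous_on_compose2[OF continuous_torus[of UNIV]]
         continuous_on_compose2[OF cont_drop[of UNIV]]) auto
  have drop_add: "drop_o (u + v) = drop_o u + drop_o v" for u v
    by (simp add: drop_o_def vec_eq_iff)
  have e_add: "e (x + z) = e x" if "z \<in> integer_points" for x z
  proof -
    obtain t u v v' where "x = (t, u)" "z = (v, v')" by (cases x, cases z)
    moreover from this have "v $ j \<in> \<int>" "drop_o v' $ j \<in> \<int>" for j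
      using that by (auto simp: mem_integer_points_prod drop_o_def)
    then have "torus h (t + v) = torus h t" "torus g (drop_o u + drop_o v') = torus g (drop_o u)"
      by (auto simp: torus_translate)
    ultimately show ?thesis
      by (simp add: e_def drop_add)
  qed
  have path_ends: "s i (e x) 0 = fst (e x)" "s i (e x) 1 = snd (e x)" if "i \<in> {1..k}" "x \<in> A i" for i x
    using mp that unfolding motion_planner_def A_def path_ends_def by (auto simp: prod_eq_iff)
  have s_cont: "continuous_map (top_of_set (F i)) (path_space (top_of_set ?X)) (s i)" if "i \<in> {1..k}" for i
    using mp that unfolding motion_planner_def by blast
  have s_in: "s i (e x) \<tau> \<in> ?X" if "i \<in> {1..k}" "x \<in> A i" "\<tau> \<in> {0..1}" for i x \<tau>
  proof -
    have "s i (e x) \<in> paths (top_of_set ?X)"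
      using continuous_map_image_subset_topspace[OF s_cont[OF that(1)]] that(2) by (auto simp: A_def)
    then show ?thesis
      using that(3) by (auto simp: paths_def pathin_def continuous_map_in_subtopology)
  qed
  have s_joint: "continuous_on (A i \<times> {0..1}) (\<lambda>(x, \<tau>). s i (e x) \<tau>)" if "i \<in> {1..k}" for i
  proof -
    have "continuous_on (A i \<times> {0..1}) (\<lambda>y. (case (e (fst y), snd y) of (p, \<tau>) \<Rightarrow> s i p \<tau>))"
      by (rule continuous_on_compose2[OF continuous_path_space_imp_joint[OF s_cont[OF that]]])
         (auto intro!: continuous_intros continuous_on_compose2[OF cont_e[of UNIV]] simp: A_def)
    then show ?thesis by (simp add: case_prod_unfold)
  qed
  have c_joint: "continuous_on (A i \<times> {0..1}) (\<lambda>(x, \<tau>). c i p q x \<tau>)" if "i \<in> {1..k}" for i p q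
    using s_joint[OF that] unfolding c_def case_prod_unfold by (intro continuous_intros)
  have c_nz: "c i p q x \<tau> \<noteq> 0" if "i \<in> {1..k}" "x \<in> A i" "\<tau> \<in> {0..1}" "p \<noteq> q" for i p q x \<tau>
    using s_in[OF that(1-3)] that(4) by (auto simp: c_def config_space_def)
  have N_int: "N i p q x \<in> \<int>" if i: "i \<in> {1..k}" and x: "x \<in> A i" and pq: "h p < h q" for i p q x
  proof -
    obtain t u where tu: "x = (t, u)" by (cases x)
    have "p \<noteq> q" using pq by auto
    have "continuous_on {0..1} (c i p q x)"
      using continuous_on_compose2[OF c_joint[OF i], of "{0..1}" "Pair x"] x
        continuous_on_Pair[OF continuous_on_const continuous_on_id]
      by (force simp: image_subset_iff)
    then have "exp (log_variation (c i p q x)) = c i p q x 1 / c i p q x 0"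
      using c_nz[OF i x] pq by (intro exp_log_variation) (auto simp: \<open>p \<noteq> q\<close>)
    moreover have "c i p q x 0 = exp (log_diff h t p q)"
      using path_ends[OF i x] pq by (simp add: c_def exp_log_diff e_def tu)
    moreover have "c i p q x 1 = - exp (log_diff g (drop_o u) q p)"
      using path_ends[OF i x] g_less[OF pq] by (simp add: c_def exp_log_diff e_def tu)
    ultimately have "exp (log_variation (c i p q x) + log_diff h t p q - log_diff g (drop_o u) q p - \<i> * pi) = 1"
      by (simp add: exp_add exp_diff)
    then obtain m :: int where "Im (log_variation (c i p q x) + log_diff h t p q
        - log_diff g (drop_o u) q p - \<i> * pi) = of_int (2 * m) * pi"
      by (auto simp only: exp_eq_1)
    then have "N i p q x = of_int m"
      by (simp add: N_def tu)
    then show ?thesis by simp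
  qed
  have N_cont: "continuous_on (A i) (N i p q)" if i: "i \<in> {1..k}" and pq: "h p < h q" for i p q
  proof -
    have "p \<noteq> q" using pq by auto
    then show ?thesis
      unfolding N_def using c_nz[OF i]
      by (intro continuous_intros continuous_log_variation c_joint[OF i]
         continuous_on_compose2[OF continuous_log_diff[OF pq, of UNIV]]
         continuous_on_compose2[OF continuous_log_diff[OF g_less[OF pq], of UNIV]]
         continuous_on_compose2[OF cont_drop[of UNIV]]) auto
  qed
  have N_add: "N i p q (x + z) = N i p q x + fst z $ q - drop_o (snd z) $ p" if "z \<in> integer_points" for i p q x z
  proof -
    obtain v v' where z: "z = (v, v')" by (cases z)
    then have "v $ j \<in> \<int>" "drop_o v' $ j \<in> \<int>" for j
      using that by (auto simp: mem_integer_points_prod drop_o_def)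
    then have "log_diff h (fst x + v) p q = log_diff h (fst x) p q + 2 * pi * \<i> * v $ q"
      "log_diff g (drop_o (snd x) + drop_o v') q p = log_diff g (drop_o (snd x)) q p + 2 * pi * \<i> * drop_o v' $ p"
      by (auto simp: log_diff_translate)
    moreover have "c i p q (x + z) = c i p q x"
      using e_add[OF that] by (simp add: c_def fun_eq_iff)
    ultimately show ?thesis
      by (simp add: N_def z drop_add field_simps)
  qed
  have f_int: "f i x \<in> integer_points" if "i \<in> {1..k}" "x \<in> A i" for i x
    using N_int[OF that] h_pos h_max \<open>a0 \<noteq> a1\<close> by (auto simp: f_def mem_integer_points_prod)
  interpret lattice_cover "{1..k}" A f \<pi> B
  proof (rule lattice_cover.intro)
    show "(\<Union>i\<in>{1..k}. A i) = UNIV"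
      using mp e_in unfolding motion_planner_def A_def by blast
  next
    fix i x z
    assume i: "i \<in> {1..k}" and x: "x \<in> A i" and z: "z \<in> (integer_points :: ((real ^ 'n) \<times> (real ^ 'n)) set)"
    show "x + z \<in> A i"
      using x e_add[OF z] by (simp add: A_def)
    show "f i (x + z) = f i x + \<pi> z"
      using N_add[OF z] by (simp add: f_def \<pi>_def drop_o_def vec_eq_iff case_prod_unfold prod_eq_iff)
  next
    fix i x assume i: "i \<in> {1..k}" and x: "x \<in> A i"
    show "f i x \<in> integer_points"
      using f_int i x by blast
    have "continuous_on (A i) (\<lambda>x. if j = a0 then 0 else N i a0 j x)" for j
      using N_cont[OF i] h_pos by (cases "j = a0") auto
    moreover have "continuous_on (A i) (\<lambda>x. if j = a0 \<or> j = a1 then 0 else N i a0 a1 x - N i j a1 x)" for j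
      using N_cont[OF i] h_max \<open>a0 \<noteq> a1\<close> by (cases "j = a0 \<or> j = a1") (auto intro!: continuous_intros)
    ultimately have "continuous_on (A i) (f i)"
      unfolding f_def by (intro continuous_intros continuous_on_vec_lambda)
    then show "\<exists>r>0. \<forall>y\<in>A i. dist x y < r \<longrightarrow> f i y = f i x"
      using integer_valued_locally_constant f_int i x by blast
  next
    show "linear \<pi>"
      by (rule linearI) (auto simp: \<pi>_def drop_o_def vec_eq_iff)
  next
    fix x :: "(real ^ 'n) \<times> (real ^ 'n)"
    obtain t u where tu: "x = (t, u)" by (cases x)
    have "x - \<pi> x = (t $ a0) *\<^sub>R (axis a0 1, 0) + (u $ a0) *\<^sub>R (0, axis a0 1) + (u $ a1) *\<^sub>R (0, axis a1 1)"
      using \<open>a0 \<noteq> a1\<close> by (auto simp: tu \<pi>_def drop_o_def vec_eq_iff axis_def)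
    also have "\<dots> \<in> span B"
      by (intro span_add span_scale span_base) (auto simp: B_def)
    finally show "x - \<pi> x \<in> span B" .
  qed (auto simp: B_def)
  obtain I where I: "I \<subseteq> {1..k}" "(\<Inter>i\<in>I. closure (A i)) \<noteq> {}"
    "DIM((real ^ 'n) \<times> (real ^ 'n)) < card I + card B"
    using closures_meet by blast
  \<comment> \<open>The dimension is \<open>2 * CARD('n)\<close>, so the strict inequality leaves
    \<open>card I\<close> greater than \<open>2 * CARD('n) - 3\<close>.\<close>
  have "card B \<le> 3"
    by (simp add: B_def card_insert_if)
  then have "2 * CARD('n) - 2 \<le> card I"
    using I(3) by simp
  moreover obtain y where y: "\<And>i. i \<in> I \<Longrightarrow> y \<in> closure (A i)"
    using I(2) by blast
  have "e y \<in> top_of_set (?X \<times> ?X) closure_of F i" if "i \<in> I" for i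
  proof -
    have "e ` closure (A i) \<subseteq> closure (F i)"
      by (rule image_closure_subset[OF cont_e]) (use closure_subset[of "F i"] in \<open>auto simp: A_def\<close>)
    moreover have "F i \<subseteq> ?X \<times> ?X"
      using mp that I(1) unfolding motion_planner_def by blast
    ultimately show ?thesis
      using e_in[of y] y[OF that] by (auto simp: closure_of_subtopology Int_absorb1)
  qed
  then have "(\<Inter>i\<in>I. top_of_set (?X \<times> ?X) closure_of F i) \<noteq> {}"
    by blast
  ultimately show ?thesis
    using I(1) by blast
qed

section \<open>A motion planner\<close>

lemma continuous_on_openin_partition:
  fixes f :: "'a::topological_space \<Rightarrow> 'b::topological_space"
  assumes "S = (\<Union>t\<in>T. P t)" and "\<And>t. t \<in> T \<Longrightarrow> openin (top_of_set S) (P t)"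
    and "\<And>t. t \<in> T \<Longrightarrow> continuous_on (P t) f"
  shows "continuous_on S f"
  unfolding continuous_openin_preimage_eq
proof (intro allI impI)
  fix B :: "'b set" assume "open B"
  have "openin (top_of_set S) (P t \<inter> f -` B)" if "t \<in> T" for t
    using assms(2,3)[OF that] continuous_openin_preimage_gen[OF _ \<open>open B\<close>] openin_trans by blast
  then have "openin (top_of_set S) (\<Union>t\<in>T. P t \<inter> f -` B)"
    by blast
  then show "openin (top_of_set S) (S \<inter> f -` B)"
    by (simp add: assms(1) Int_UN_distrib2)
qed

text \<open>Each part is also relatively closed, as the complement of the union of the others, so
  induction can use the gluing of ENRs along closed sets.\<close>

lemma ENR_openin_partition:
  fixes P :: "'i \<Rightarrow> 'a::euclidean_space set"
  assumes "finite T" and "disjoint_family_on P T" and "\<And>t. t \<in> T \<Longrightarrow> ENR (P t)"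
    and "\<And>t. t \<in> T \<Longrightarrow> openin (top_of_set (\<Union>t\<in>T. P t)) (P t)"
  shows "ENR (\<Union>t\<in>T. P t)"
  using assms
proof (induction T rule: finite_induct)
  case (insert t T)
  let ?S = "\<Union>t\<in>insert t T. P t" and ?R = "\<Union>t\<in>T. P t"
  have "P t \<inter> P t' = {}" if "t' \<in> T" for t'
    using insert.prems(1) insert.hyps(2) that unfolding disjoint_family_on_def by (metis insertCI)
  then have disj: "P t \<inter> ?R = {}" by blast
  have S: "?S = P t \<union> ?R" by simp
  have openR: "openin (top_of_set ?S) ?R"
    using insert.prems(3) by (intro openin_Union) auto
  have openP: "openin (top_of_set ?S) (P t)"
    using insert.prems(3) by blast
  have "openin (top_of_set ?R) (P t')" if "t' \<in> T" for t'
    using insert.prems(3)[of t'] that by (intro openin_subset_trans[of ?S "P t'" ?R]) auto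
  then have "ENR ?R"
    using insert.prems insert.IH by (auto simp: disjoint_family_on_def)
  moreover have "closedin (top_of_set (P t \<union> ?R)) (P t)"
  proof -
    have "P t = (P t \<union> ?R) - ?R" using disj by blast
    then show ?thesis
      using openR unfolding S by (metis closedin_diff closedin_topspace topspace_euclidean_subtopology)
  qed
  moreover have "closedin (top_of_set (P t \<union> ?R)) ?R"
  proof -
    have "?R = (P t \<union> ?R) - P t" using disj by blast
    then show ?thesis
      using openP unfolding S by (metis closedin_diff closedin_topspace topspace_euclidean_subtopology)
  qed
  ultimately show ?case
    unfolding S using insert.prems(2) disj by (intro ENR_closedin_Un_local) auto
qed simp

text \<open>\<open>f\<close> factors through \<open>g\<close> by a map of \<open>range g\<close>
  onto \<open>range f\<close>, which is injective if these finite sets have equal size.\<close>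

lemma card_range_eq_imp_same_fibres:
  fixes f :: "'a::finite \<Rightarrow> 'b" and g :: "'a \<Rightarrow> 'c"
  assumes fg: "\<And>a b. g a = g b \<Longrightarrow> f a = f b"
  shows "card (range f) \<le> card (range g)"
    and "card (range f) = card (range g) \<Longrightarrow> f a = f b \<Longrightarrow> g a = g b"
proof -
  define h where "h r = f (SOME a. g a = r)" for r
  have "h (g a) = f a" for a
    unfolding h_def by (rule someI2[of _ a]) (auto intro: fg)
  then have h: "f a = h (g a)" for a by simp
  then have range: "range f = h ` range g" by auto
  then show "card (range f) \<le> card (range g)"
    by (simp add: card_image_le)
  assume "card (range f) = card (range g)" "f a = f b"
  then show "g a = g b"
    using h range eq_card_imp_inj_on[of "range g" h] by (metis finite finite_imageI inj_onD rangeI)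
qed

section \<open>Projections to the line through two anchor points\<close>

locale anchored =
  fixes a\<^sub>1 a\<^sub>2 :: "'n::finite" and \<kappa> :: "'n \<Rightarrow> nat"
  assumes anchors: "a\<^sub>1 \<noteq> a\<^sub>2" and inj_\<kappa>: "inj \<kappa>"
begin

abbreviation X :: "((real ^ 2) ^ 'n) set" where
  "X \<equiv> config_space"

definition dir :: "(real ^ 2) ^ 'n \<Rightarrow> complex" where
  "dir x = sgn (planar (x $ a\<^sub>2) - planar (x $ a\<^sub>1))"

text \<open>In these coordinates the direction between the anchors is the positive real axis, so
  \<open>Re\<close> is the projection to that line and \<open>Im\<close> the height across
  it.\<close>

definition rot :: "(real ^ 2) ^ 'n \<Rightarrow> 'n \<Rightarrow> complex" where
  "rot x a = planar (x $ a) * cnj (dir x)"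

definition coaligned :: "(real ^ 2) ^ 'n \<Rightarrow> ('n \<times> 'n) set" where
  "coaligned x = {(a, b). Re (rot x a) = Re (rot x b)}"

definition levels :: "(real ^ 2) ^ 'n \<Rightarrow> nat" where
  "levels x = card (range (\<lambda>a. coaligned x `` {a}))"

lemma anchor_diff: "x \<in> X \<Longrightarrow> planar (x $ a\<^sub>2) - planar (x $ a\<^sub>1) \<noteq> 0"
  using anchors by (auto simp: config_space_def)

lemma norm_dir: "x \<in> X \<Longrightarrow> cmod (dir x) = 1"
  using anchor_diff by (simp add: dir_def norm_sgn)

lemma dir_cnj: "x \<in> X \<Longrightarrow> dir x * cnj (dir x) = 1"
  using norm_dir by (simp add: complex_norm_square[symmetric])

lemma planar_eq_rot: "x \<in> X \<Longrightarrow> planar (x $ a) = rot x a * dir x"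
  using dir_cnj[of x] by (simp add: rot_def mult.assoc mult.commute[of "cnj _"])

lemma rot_eq_iff: "x \<in> X \<Longrightarrow> rot x a = rot x b \<longleftrightarrow> a = b"
  using planar_eq_rot[of x a] planar_eq_rot[of x b] planar_eq_iff[of "x $ a" "x $ b"]
  by (auto simp: config_space_def)

lemma rot_anchors:
  assumes "x \<in> X"
  shows "rot x a\<^sub>2 - rot x a\<^sub>1 = cmod (planar (x $ a\<^sub>2) - planar (x $ a\<^sub>1))"
proof -
  define d where "d = planar (x $ a\<^sub>2) - planar (x $ a\<^sub>1)"
  have "rot x a\<^sub>2 - rot x a\<^sub>1 = d * cnj (sgn d)"
    by (simp add: rot_def dir_def d_def left_diff_distrib)
  also have "\<dots> = cmod d"
    by (simp add: sgn_eq complex_norm_square[symmetric] power2_eq_square)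
  finally show ?thesis by (simp add: d_def)
qed

lemma Re_rot_anchors: "x \<in> X \<Longrightarrow> Re (rot x a\<^sub>1) < Re (rot x a\<^sub>2)"
  and Im_rot_anchors: "x \<in> X \<Longrightarrow> Im (rot x a\<^sub>1) = Im (rot x a\<^sub>2)"
proof -
  assume x: "x \<in> X"
  have "Re (rot x a\<^sub>2 - rot x a\<^sub>1) > 0" "Im (rot x a\<^sub>2 - rot x a\<^sub>1) = 0"
    unfolding rot_anchors[OF x] using anchor_diff[OF x] by auto
  then show "Re (rot x a\<^sub>1) < Re (rot x a\<^sub>2)" "Im (rot x a\<^sub>1) = Im (rot x a\<^sub>2)"
    by auto
qed

lemma continuous_on_dir [continuous_intros]:
  assumes "continuous_on S g" "\<And>z. z \<in> S \<Longrightarrow> g z \<in> X"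
  shows "continuous_on S (\<lambda>z. dir (g z))"
  unfolding dir_def using assms anchor_diff by (intro continuous_intros) auto

lemma continuous_on_rot [continuous_intros]:
  assumes "continuous_on S g" "\<And>z. z \<in> S \<Longrightarrow> g z \<in> X"
  shows "continuous_on S (\<lambda>z. rot (g z) a)"
  unfolding rot_def using assms by (intro continuous_intros) auto

lemma open_X: "open X"
proof -
  have "X = (\<Inter>(i, j)\<in>{(i, j). i \<noteq> j}. {x. x $ i \<noteq> x $ j})"
    by (auto simp: config_space_def)
  also have "open \<dots>"
    by (intro open_INT) (auto intro!: open_Collect_neq continuous_intros)
  finally show ?thesis .
qed

lemma coaligned_class_eq_iff: "coaligned x `` {a} = coaligned x `` {b} \<longleftrightarrow> (a, b) \<in> coaligned x"
  by (auto simp: coaligned_def)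

lemma levels_bounds:
  assumes "x \<in> X"
  shows "2 \<le> levels x" "levels x \<le> CARD('n)"
proof -
  have "(a\<^sub>1, a\<^sub>2) \<notin> coaligned x"
    using Re_rot_anchors[OF assms] by (simp add: coaligned_def)
  then have "card {coaligned x `` {a\<^sub>1}, coaligned x `` {a\<^sub>2}} = 2"
    using coaligned_class_eq_iff by simp
  then show "2 \<le> levels x"
    unfolding levels_def by (metis (no_types, lifting) card_mono empty_subsetI finite finite_imageI insert_subset rangeI)
  show "levels x \<le> CARD('n)"
    unfolding levels_def by (simp add: card_image_le)
qed

lemma levels_mono:
  assumes "coaligned x \<subseteq> coaligned y"
  shows "levels y \<le> levels x" "levels y = levels x \<Longrightarrow> coaligned y = coaligned x"
proof -
  have *: "coaligned y `` {a} = coaligned y `` {b}" if "coaligned x `` {a} = coaligned x `` {b}" for a b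
    using that assms coaligned_class_eq_iff by blast
  show "levels y \<le> levels x"
    unfolding levels_def by (rule card_range_eq_imp_same_fibres(1)[OF *])
  assume "levels y = levels x"
  then have card: "card (range (\<lambda>a. coaligned y `` {a})) = card (range (\<lambda>a. coaligned x `` {a}))"
    by (simp only: levels_def)
  have "coaligned x `` {a} = coaligned x `` {b}" if "coaligned y `` {a} = coaligned y `` {b}" for a b
    by (rule card_range_eq_imp_same_fibres(2)[where f = "\<lambda>a. coaligned y `` {a}"
        and g = "\<lambda>a. coaligned x `` {a}", OF _ card that]) (rule *)
  then show "coaligned y = coaligned x"
    using assms unfolding coaligned_class_eq_iff by auto
qed

section \<open>Strata and their pieces\<close>

definition stratum :: "nat \<Rightarrow> (((real ^ 2) ^ 'n) \<times> ((real ^ 2) ^ 'n)) set" where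
  "stratum l = {(x, y) \<in> X \<times> X. levels x + levels y + of_bool (dir y \<noteq> - dir x) = l + 3}"

definition piece :: "('n \<times> 'n) set \<times> ('n \<times> 'n) set \<times> bool \<Rightarrow> (((real ^ 2) ^ 'n) \<times> ((real ^ 2) ^ 'n)) set" where
  "piece t = {(x, y) \<in> X \<times> X. (coaligned x, coaligned y, dir y = - dir x) = t}"

lemma piece_subset_stratum:
  assumes "z \<in> stratum l" "z \<in> piece t"
  shows "piece t \<subseteq> stratum l"
  using assms unfolding stratum_def piece_def levels_def by auto

lemma stratum_eq: "stratum l = (\<Union>t\<in>{t. piece t \<inter> stratum l \<noteq> {}}. piece t)"
proof
  show "stratum l \<subseteq> (\<Union>t\<in>{t. piece t \<inter> stratum l \<noteq> {}}. piece t)"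
  proof
    fix z assume z: "z \<in> stratum l"
    obtain x y where xy: "z = (x, y)" by (cases z)
    have "z \<in> piece (coaligned x, coaligned y, dir y = - dir x)"
      using z unfolding xy stratum_def piece_def by blast
    then show "z \<in> (\<Union>t\<in>{t. piece t \<inter> stratum l \<noteq> {}}. piece t)"
      using z by blast
  qed
qed (use piece_subset_stratum in blast)

lemma disjoint_pieces: "disjoint_family_on piece T"
  by (auto simp: disjoint_family_on_def piece_def)

lemma open_noncoaligned: "open {x \<in> X. - R \<subseteq> - coaligned x}"
proof -
  have "open (X \<inter> (\<lambda>x. Re (rot x a) - Re (rot x b)) -` (- {0}))" for a b
    by (intro continuous_open_preimage open_X continuous_intros) auto
  then have "open (X \<inter> (\<Inter>(a, b)\<in>- R. X \<inter> (\<lambda>x. Re (rot x a) - Re (rot x b)) -` (- {0})))"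
    by (intro open_Int open_X open_INT) auto
  also have "X \<inter> (\<Inter>(a, b)\<in>- R. X \<inter> (\<lambda>x. Re (rot x a) - Re (rot x b)) -` (- {0})) = {x \<in> X. - R \<subseteq> - coaligned x}"
    by (fastforce simp: coaligned_def)
  finally show ?thesis .
qed

lemma open_not_opposite: "open {(x, y) \<in> X \<times> X. dir y \<noteq> - dir x}"
proof -
  have "open ((X \<times> X) \<inter> (\<lambda>z. dir (snd z) + dir (fst z)) -` (- {0}))"
    by (intro continuous_open_preimage open_Times open_X continuous_intros) auto
  also have "(X \<times> X) \<inter> (\<lambda>z. dir (snd z) + dir (fst z)) -` (- {0}) = {(x, y) \<in> X \<times> X. dir y \<noteq> - dir x}"
    by (auto simp: add_eq_0_iff2)
  finally show ?thesis .
qed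

text \<open>Near a configuration no new coincidences of projections occur, so on a stratum, where the
  sum of the three terms is fixed, none of them can change.\<close>

lemma openin_piece:
  assumes "piece t \<inter> stratum l \<noteq> {}"
  shows "openin (top_of_set (stratum l)) (piece t)"
proof -
  obtain x\<^sub>0 y\<^sub>0 where z: "(x\<^sub>0, y\<^sub>0) \<in> piece t" "(x\<^sub>0, y\<^sub>0) \<in> stratum l"
    using assms by auto
  have t: "t = (coaligned x\<^sub>0, coaligned y\<^sub>0, dir y\<^sub>0 = - dir x\<^sub>0)"
    using z(1) unfolding piece_def by blast
  define N where "N = {x \<in> X. - coaligned x\<^sub>0 \<subseteq> - coaligned x} \<times> {y \<in> X. - coaligned y\<^sub>0 \<subseteq> - coaligned y} \<inter>
    (if dir y\<^sub>0 = - dir x\<^sub>0 then UNIV else {(x, y) \<in> X \<times> X. dir y \<noteq> - dir x})"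
  have "open N"
    unfolding N_def by (intro open_Int open_Times open_noncoaligned) (use open_not_opposite in auto)
  moreover have "piece t = stratum l \<inter> N"
  proof
    show "piece t \<subseteq> stratum l \<inter> N"
      using piece_subset_stratum[OF z(2,1)] by (auto simp: N_def piece_def t)
    show "stratum l \<inter> N \<subseteq> piece t"
    proof clarify
      fix x y assume xy: "(x, y) \<in> stratum l" "(x, y) \<in> N"
      have X: "x \<in> X" "y \<in> X" using xy(1) by (auto simp: stratum_def)
      have sub: "coaligned x \<subseteq> coaligned x\<^sub>0" "coaligned y \<subseteq> coaligned y\<^sub>0"
        using xy(2) by (auto simp: N_def)
      have "levels x + levels y + of_bool (dir y \<noteq> - dir x)
          = levels x\<^sub>0 + levels y\<^sub>0 + of_bool (dir y\<^sub>0 \<noteq> - dir x\<^sub>0)"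
        using xy(1) z(2) by (simp add: stratum_def)
      moreover have "dir y\<^sub>0 \<noteq> - dir x\<^sub>0 \<Longrightarrow> dir y \<noteq> - dir x"
        using xy(2) by (auto simp: N_def)
      ultimately have "levels x\<^sub>0 = levels x \<and> levels y\<^sub>0 = levels y \<and> (dir y = - dir x) = (dir y\<^sub>0 = - dir x\<^sub>0)"
        using levels_mono(1)[OF sub(1)] levels_mono(1)[OF sub(2)] by (auto simp: of_bool_def split: if_splits)
      then show "(x, y) \<in> piece t"
        using levels_mono(2)[OF sub(1)] levels_mono(2)[OF sub(2)] X by (simp add: piece_def t)
    qed
  qed
  ultimately show ?thesis
    by (auto simp: openin_open)
qed

section \<open>Retractions onto the pieces\<close>

definition rep :: "('n \<times> 'n) set \<Rightarrow> 'n \<Rightarrow> 'n" where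
  "rep R a = (SOME b. b \<in> R `` {a})"

lemma rep_coaligned:
  shows "(a, rep (coaligned x) a) \<in> coaligned x"
    and "(a, b) \<in> coaligned x \<Longrightarrow> rep (coaligned x) a = rep (coaligned x) b"
proof -
  have "a \<in> coaligned x `` {a}" by (simp add: coaligned_def)
  then have "rep (coaligned x) a \<in> coaligned x `` {a}"
    unfolding rep_def by (rule someI)
  then show "(a, rep (coaligned x) a) \<in> coaligned x" by simp
  show "(a, b) \<in> coaligned x \<Longrightarrow> rep (coaligned x) a = rep (coaligned x) b"
    by (metis coaligned_class_eq_iff rep_def)
qed

text \<open>Each point slides parallel to \<open>dir x\<close>, at constant height, until it
  projects where the representative of its class does.\<close>

definition push :: "('n \<times> 'n) set \<Rightarrow> (real ^ 2) ^ 'n \<Rightarrow> (real ^ 2) ^ 'n" where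
  "push R x = config (\<lambda>a. Complex (Re (rot x (rep R a))) (Im (rot x a)) * dir x)"

text \<open>Open conditions under which \<open>push R\<close> stays in \<open>X\<close>: the anchors
  keep their order, hence \<open>dir\<close> is preserved; different classes stay apart; points of
  one class differ in height.\<close>

definition pushable :: "('n \<times> 'n) set \<Rightarrow> ((real ^ 2) ^ 'n) set" where
  "pushable R = {x \<in> X. Re (rot x (rep R a\<^sub>1)) < Re (rot x (rep R a\<^sub>2)) \<and>
     (\<forall>(a, b)\<in>- R. Re (rot x (rep R a)) \<noteq> Re (rot x (rep R b))) \<and>
     (\<forall>(a, b)\<in>R - Id. Im (rot x a) \<noteq> Im (rot x b))}"

lemma open_pushable: "open (pushable R)"
proof -
  have 1: "open (X \<inter> (\<lambda>x. Re (rot x (rep R a\<^sub>2)) - Re (rot x (rep R a\<^sub>1))) -` {0<..})"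
    by (intro continuous_open_preimage open_X continuous_intros) auto
  have 2: "open (X \<inter> (\<lambda>x. Re (rot x (rep R a)) - Re (rot x (rep R b))) -` (- {0}))" for a b
    by (intro continuous_open_preimage open_X continuous_intros) auto
  have 3: "open (X \<inter> (\<lambda>x. Im (rot x a) - Im (rot x b)) -` (- {0}))" for a b
    by (intro continuous_open_preimage open_X continuous_intros) auto
  have "open ((X \<inter> (\<lambda>x. Re (rot x (rep R a\<^sub>2)) - Re (rot x (rep R a\<^sub>1))) -` {0<..})
     \<inter> (\<Inter>(a, b)\<in>- R. X \<inter> (\<lambda>x. Re (rot x (rep R a)) - Re (rot x (rep R b))) -` (- {0}))
     \<inter> (\<Inter>(a, b)\<in>R - Id. X \<inter> (\<lambda>x. Im (rot x a) - Im (rot x b)) -` (- {0})))"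
    using 2 3 by (intro open_Int[OF open_Int[OF 1]] open_INT) auto
  also have "\<dots> = pushable R"
    by (fastforce simp: pushable_def)
  finally show ?thesis .
qed

lemma continuous_on_push [continuous_intros]:
  assumes "continuous_on S g" "\<And>z. z \<in> S \<Longrightarrow> g z \<in> X"
  shows "continuous_on S (\<lambda>z. push R (g z))"
  unfolding push_def Complex_eq using assms by (intro continuous_intros) auto

text \<open>The difference of the anchors is a positive multiple of \<open>d\<close>, so normalising
  it returns \<open>d\<close>, and undoing the rotation returns \<open>f\<close>.\<close>

lemma frame_config:
  assumes d: "cmod d = 1" and inj: "inj f"
    and Re: "Re (f a\<^sub>1) < Re (f a\<^sub>2)" and Im: "Im (f a\<^sub>1) = Im (f a\<^sub>2)"
  shows "config (\<lambda>a. f a * d) \<in> X" "dir (config (\<lambda>a. f a * d)) = d" "rot (config (\<lambda>a. f a * d)) a = f a"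
proof -
  have dd: "d * cnj d = 1"
    using d by (simp add: complex_norm_square[symmetric])
  have "d \<noteq> 0" using d by auto
  then show "config (\<lambda>a. f a * d) \<in> X"
    using inj by (auto simp: config_in_config_space inj_def)
  have "f a\<^sub>2 - f a\<^sub>1 = complex_of_real (Re (f a\<^sub>2) - Re (f a\<^sub>1))"
    using Im by (simp add: complex_eq_iff)
  then have "f a\<^sub>2 * d - f a\<^sub>1 * d = (Re (f a\<^sub>2) - Re (f a\<^sub>1)) *\<^sub>R d"
    by (metis left_diff_distrib scaleR_conv_of_real)
  then show dir: "dir (config (\<lambda>a. f a * d)) = d"
    using Re d by (simp add: dir_def sgn_scaleR sgn_div_norm)
  show "rot (config (\<lambda>a. f a * d)) a = f a"
    unfolding rot_def dir using dd by (simp add: mult.assoc)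
qed

lemma push:
  assumes x: "x \<in> pushable (coaligned x\<^sub>0)" and x\<^sub>0: "x\<^sub>0 \<in> X"
  shows "push (coaligned x\<^sub>0) x \<in> X" "dir (push (coaligned x\<^sub>0) x) = dir x"
    "coaligned (push (coaligned x\<^sub>0) x) = coaligned x\<^sub>0"
proof -
  let ?R = "coaligned x\<^sub>0"
  let ?f = "\<lambda>a. Complex (Re (rot x (rep ?R a))) (Im (rot x a))"
  have X: "x \<in> X" using x by (simp add: pushable_def)
  have ne: "Re (rot x (rep ?R a)) \<noteq> Re (rot x (rep ?R b))" if "(a, b) \<notin> ?R" for a b
    using x that unfolding pushable_def by blast
  have "inj ?f"
  proof (rule injI)
    fix a b assume "?f a = ?f b"
    then have eq: "Re (rot x (rep ?R a)) = Re (rot x (rep ?R b))" "Im (rot x a) = Im (rot x b)"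
      by auto
    then have "(a, b) \<in> ?R" using ne by blast
    then show "a = b"
      using x eq(2) unfolding pushable_def by blast
  qed
  moreover have "Re (?f a\<^sub>1) < Re (?f a\<^sub>2)" "Im (?f a\<^sub>1) = Im (?f a\<^sub>2)"
    using x Im_rot_anchors[OF X] by (auto simp: pushable_def)
  ultimately have *: "push ?R x \<in> X" "dir (push ?R x) = dir x" "rot (push ?R x) a = ?f a" for a
    unfolding push_def using frame_config[OF norm_dir[OF X], of ?f] by auto
  then show "push ?R x \<in> X" "dir (push ?R x) = dir x" by auto
  show "coaligned (push ?R x) = ?R"
    using ne rep_coaligned(2) unfolding coaligned_def[of "push ?R x"] *(3) by auto
qed

lemma pushable_coaligned:
  assumes x: "x \<in> X"
  shows "x \<in> pushable (coaligned x)" "push (coaligned x) x = x"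
proof -
  have Re: "Re (rot x (rep (coaligned x) a)) = Re (rot x a)" for a
    using rep_coaligned(1)[of a x] by (simp add: coaligned_def)
  have ne: "Re (rot x a) \<noteq> Re (rot x b)" if "(a, b) \<in> - coaligned x" for a b
    using that by (simp add: coaligned_def)
  have ne': "Im (rot x a) \<noteq> Im (rot x b)" if "(a, b) \<in> coaligned x - Id" for a b
    using that rot_eq_iff[OF x, of a b] by (auto simp: coaligned_def complex_eq_iff)
  show "x \<in> pushable (coaligned x)"
    unfolding pushable_def using x Re_rot_anchors[OF x] ne ne' by (auto simp: Re)
  show "push (coaligned x) x = x"
    using planar_eq_rot[OF x] by (simp add: push_def Re flip: planar_eq_rot[OF x])
qed

definition spin :: "complex \<Rightarrow> (real ^ 2) ^ 'n \<Rightarrow> (real ^ 2) ^ 'n" where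
  "spin c x = config (\<lambda>a. planar (x $ a) * c)"

lemma spin:
  assumes x: "x \<in> X" and c: "cmod c = 1"
  shows "spin c x \<in> X" "dir (spin c x) = dir x * c" "coaligned (spin c x) = coaligned x"
proof -
  have eq: "spin c x = config (\<lambda>a. rot x a * (dir x * c))"
    unfolding spin_def using planar_eq_rot[OF x] by (simp add: mult.assoc)
  have "cmod (dir x * c) = 1" using norm_dir[OF x] c by (simp add: norm_mult)
  then have *: "spin c x \<in> X" "dir (spin c x) = dir x * c" "rot (spin c x) a = rot x a" for a
    unfolding eq using frame_config[of "dir x * c" "rot x"] rot_eq_iff[OF x]
      Re_rot_anchors[OF x] Im_rot_anchors[OF x] by (auto simp: inj_def)
  then show "spin c x \<in> X" "dir (spin c x) = dir x * c" "coaligned (spin c x) = coaligned x"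
    by (auto simp: coaligned_def)
qed

text \<open>A nonempty piece is a retract of an open set by pushing both configurations.
  Non-opposite directions form an open condition that \<open>push\<close> preserves; opposite ones
  are enforced by rotating the second configuration.\<close>

lemma ENR_piece: "ENR (piece t)"
proof (cases "piece t = {}")
  case False
  then obtain x\<^sub>0 y\<^sub>0 where z: "(x\<^sub>0, y\<^sub>0) \<in> piece t" by auto
  have t: "t = (coaligned x\<^sub>0, coaligned y\<^sub>0, dir y\<^sub>0 = - dir x\<^sub>0)"
    using z unfolding piece_def by blast
  have X: "x\<^sub>0 \<in> X" "y\<^sub>0 \<in> X"
    using z by (auto simp: piece_def)
  let ?R = "coaligned x\<^sub>0" and ?R' = "coaligned y\<^sub>0"
  have sub: "pushable ?R \<subseteq> X" "pushable ?R' \<subseteq> X" by (auto simp: pushable_def)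
  show ?thesis
  proof (cases "dir y\<^sub>0 = - dir x\<^sub>0")
    case False
    let ?U = "pushable ?R \<times> pushable ?R' \<inter> {(x, y) \<in> X \<times> X. dir y \<noteq> - dir x}"
    have "retraction ?U (piece t) (\<lambda>z. (push ?R (fst z), push ?R' (snd z)))"
      unfolding retraction_def
    proof (intro conjI)
      show "piece t \<subseteq> ?U"
        using pushable_coaligned(1) False by (force simp: piece_def t)
      show "continuous_on ?U (\<lambda>z. (push ?R (fst z), push ?R' (snd z)))"
        using sub by (intro continuous_intros) auto
      show "(\<lambda>z. (push ?R (fst z), push ?R' (snd z))) \<in> ?U \<rightarrow> piece t"
        using push X False by (auto simp: piece_def t)
      show "\<forall>z\<in>piece t. (push ?R (fst z), push ?R' (snd z)) = z"
        using pushable_coaligned(2) by (auto simp: piece_def t) metis+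
    qed
    moreover have "open ?U"
      by (intro open_Int open_Times open_pushable open_not_opposite)
    ultimately show ?thesis
      unfolding ENR_def retract_of_def by blast
  next
    case True
    let ?U = "pushable ?R \<times> pushable ?R'"
    \<comment> \<open>Multiplication by this unit number takes \<open>dir (snd z)\<close> to
      \<open>- dir (fst z)\<close>; on the piece it equals 1.\<close>
    let ?c = "\<lambda>z. - dir (fst z) * cnj (dir (snd z))"
    let ?r = "\<lambda>z. (push ?R (fst z), spin (?c z) (push ?R' (snd z)))"
    have "retraction ?U (piece t) ?r"
      unfolding retraction_def
    proof (intro conjI)
      show "piece t \<subseteq> ?U"
        using pushable_coaligned(1) by (force simp: piece_def t)
      show "continuous_on ?U ?r"
        unfolding spin_def using sub by (intro continuous_intros) auto
      show "?r \<in> ?U \<rightarrow> piece t"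
      proof
        fix z assume "z \<in> ?U"
        then obtain x y where xy: "z = (x, y)" "x \<in> pushable ?R" "y \<in> pushable ?R'" by blast
        have "x \<in> X" "y \<in> X" using xy sub by auto
        then have c: "cmod (?c z) = 1" "dir y * ?c z = - dir x"
          using norm_dir[of x] norm_dir[of y] dir_cnj[of y] by (simp_all add: xy(1) norm_mult)
        show "?r z \<in> piece t"
          using push[OF xy(2) X(1)] push[OF xy(3) X(2)] spin[OF push(1)[OF xy(3) X(2)] c(1)] c(2) True xy(1)
          by (simp add: piece_def t)
      qed
      show "\<forall>z\<in>piece t. ?r z = z"
      proof
        fix z assume z: "z \<in> piece t"
        obtain x y where xy: "z = (x, y)" by (cases z)
        have *: "x \<in> X" "y \<in> X" "coaligned x = ?R" "coaligned y = ?R'" "dir y = - dir x"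
          using z True unfolding piece_def t xy by auto
        then have "?c z = 1" using dir_cnj[of x] by (simp add: xy)
        then show "?r z = z"
          using pushable_coaligned(2)[OF *(1)] pushable_coaligned(2)[OF *(2)] *
          by (simp add: xy spin_def)
      qed
    qed
    moreover have "open ?U"
      by (intro open_Times open_pushable)
    ultimately show ?thesis
      unfolding ENR_def retract_of_def by blast
  qed
qed simp

lemma ENR_stratum: "ENR (stratum l)"
proof -
  have "ENR (\<Union>t\<in>{t. piece t \<inter> stratum l \<noteq> {}}. piece t)"
    using disjoint_pieces ENR_piece openin_piece
    by (intro ENR_openin_partition) (simp_all flip: stratum_eq)
  then show ?thesis
    by (simp flip: stratum_eq)
qed

section \<open>Construction of the motions\<close>

definition scale :: "(real ^ 2) ^ 'n \<Rightarrow> real" where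
  "scale x = 1 / (1 + (\<Sum>(a, b)\<in>UNIV. \<bar>real (\<kappa> a) - \<kappa> b\<bar> / \<bar>Re (rot x a) - Re (rot x b)\<bar>))"

text \<open>Coaligned pairs contribute 0 to the sum, as division by 0 gives 0. For other pairs
  \<open>1 / scale x\<close> exceeds their own summand.\<close>

lemma scale:
  shows "scale x > 0"
    and "(a, b) \<notin> coaligned x \<Longrightarrow> scale x * \<bar>real (\<kappa> a) - \<kappa> b\<bar> < \<bar>Re (rot x a) - Re (rot x b)\<bar>"
proof -
  let ?g = "\<lambda>(a, b). \<bar>real (\<kappa> a) - \<kappa> b\<bar> / \<bar>Re (rot x a) - Re (rot x b)\<bar>"
  have nonneg: "?g z \<ge> 0" for z by (cases z) simp
  then have pos: "1 + sum ?g UNIV > 0"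
    by (intro add_pos_nonneg sum_nonneg) auto
  then show "scale x > 0"
    unfolding scale_def by simp
  assume "(a, b) \<notin> coaligned x"
  then have ab: "\<bar>Re (rot x a) - Re (rot x b)\<bar> > 0" by (simp add: coaligned_def)
  have "?g (a, b) \<le> sum ?g UNIV"
    using nonneg by (intro member_le_sum) auto
  then have "\<bar>real (\<kappa> a) - \<kappa> b\<bar> / \<bar>Re (rot x a) - Re (rot x b)\<bar> < 1 + sum ?g UNIV"
    by simp
  then show "scale x * \<bar>real (\<kappa> a) - \<kappa> b\<bar> < \<bar>Re (rot x a) - Re (rot x b)\<bar>"
    unfolding scale_def using ab pos by (simp add: field_simps)
qed

text \<open>The term \<open>t * scale x * \<kappa> a\<close> separates the points whose projections coincide, and is too small
  to let the other projections meet. At time 1 the points have reached a position on the line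
  orthogonal to \<open>dir x\<close> that depends on \<open>x\<close> only through \<open>dir x\<close>.\<close>

definition comb :: "(real ^ 2) ^ 'n \<Rightarrow> real \<Rightarrow> 'n \<Rightarrow> complex" where
  "comb x t a = Complex ((1 - t) * (Re (rot x a) + t * scale x * \<kappa> a)) ((1 - t) * Im (rot x a) + t * \<kappa> a) * dir x"

lemma comb_0: "x \<in> X \<Longrightarrow> comb x 0 a = planar (x $ a)"
  by (simp add: comb_def planar_eq_rot)

lemma comb_1: "comb x 1 a = \<i> * \<kappa> a * dir x"
  by (simp add: comb_def complex_eq_iff)

text \<open>Equal heights exclude \<open>t = 1\<close>, so the projections can be compared. A
  coaligned pair then forces \<open>t = 0\<close>, where \<open>rot x\<close> separates it; for
  other pairs the gap exceeds the perturbation by \<open>scale\<close>.\<close>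

lemma inj_comb:
  assumes x: "x \<in> X" and t: "t \<in> {0..1}"
  shows "inj (comb x t)"
proof (rule injI, rule ccontr)
  fix a b assume eq: "comb x t a = comb x t b" and ab: "a \<noteq> b"
  have \<kappa>: "real (\<kappa> a) \<noteq> \<kappa> b" using inj_\<kappa> ab by (auto simp: inj_eq)
  have "dir x \<noteq> 0" using norm_dir[OF x] by auto
  then have Re: "(1 - t) * (Re (rot x a) + t * scale x * \<kappa> a) = (1 - t) * (Re (rot x b) + t * scale x * \<kappa> b)"
    and Im: "(1 - t) * Im (rot x a) + t * \<kappa> a = (1 - t) * Im (rot x b) + t * \<kappa> b"
    using eq by (auto simp: comb_def)
  have "t \<noteq> 1" using Im \<kappa> by auto
  then have "Re (rot x a) + t * scale x * \<kappa> a = Re (rot x b) + t * scale x * \<kappa> b"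
    using Re by simp
  then have Re': "Re (rot x a) - Re (rot x b) = t * (scale x * (real (\<kappa> b) - real (\<kappa> a)))"
    by (simp add: algebra_simps)
  show False
  proof (cases "(a, b) \<in> coaligned x")
    case True
    then have "t * (scale x * (real (\<kappa> b) - \<kappa> a)) = 0"
      using Re' by (simp add: coaligned_def)
    then have "t = 0" using scale(1)[of x] \<kappa> by simp
    then have "rot x a = rot x b"
      using True Im by (simp add: coaligned_def complex_eq_iff)
    then show False using rot_eq_iff[OF x] ab by blast
  next
    case False
    have "\<bar>Re (rot x a) - Re (rot x b)\<bar> = t * (scale x * \<bar>real (\<kappa> a) - \<kappa> b\<bar>)"
      unfolding Re' using t scale(1)[of x] by (simp add: abs_mult abs_minus_commute)
    also have "\<dots> \<le> 1 * (scale x * \<bar>real (\<kappa> a) - \<kappa> b\<bar>)"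
      using t scale(1)[of x] by (intro mult_right_mono) auto
    finally show False
      using scale(2)[OF False] by simp
  qed
qed

text \<open>The segment between unit vectors misses 0 unless they are opposite, when a half circle
  replaces it. Being nonzero is enough to keep the points
  \<open>\<i> * \<kappa> a * turn d d' t\<close> distinct, so the norm may vary.\<close>

definition turn :: "complex \<Rightarrow> complex \<Rightarrow> real \<Rightarrow> complex" where
  "turn d d' t = (if d' = - d then d * cis (pi * t) else (1 - t) *\<^sub>R d + t *\<^sub>R d')"

lemma turn_0 [simp]: "turn d d' 0 = d" and turn_1 [simp]: "turn d d' 1 = d'"
  by (auto simp: turn_def)

lemma turn_nonzero:
  assumes "cmod d = 1" "cmod d' = 1" "t \<in> {0..1}"
  shows "turn d d' t \<noteq> 0"
proof (cases "d' = - d")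
  case False
  show ?thesis
  proof
    assume "turn d d' t = 0"
    then have eq: "t *\<^sub>R d' = - ((1 - t) *\<^sub>R d)"
      using False by (simp add: turn_def eq_neg_iff_add_eq_0 add.commute)
    then have "cmod (t *\<^sub>R d') = cmod ((1 - t) *\<^sub>R d)"
      by (metis norm_minus_cancel)
    then have "t = 1 / 2" using assms by simp
    then have "(1 / 2) *\<^sub>R d' = (1 / 2) *\<^sub>R (- d)" using eq[unfolded \<open>t = 1 / 2\<close>] by simp
    then have "d' = - d" by (subst (asm) scaleR_cancel_left) simp
    then show False using False by blast
  qed
qed (use assms in \<open>auto simp: turn_def\<close>)

definition clamp01 :: "real \<Rightarrow> real" where
  "clamp01 t = max 0 (min 1 t)"

text \<open>At every time all but one of the three motions rest, so that their contributions
  cancel at the common intermediate positions. Summing them avoids a case distinction in the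
  continuity proof.\<close>

definition plan :: "((real ^ 2) ^ 'n) \<times> ((real ^ 2) ^ 'n) \<Rightarrow> real \<Rightarrow> (real ^ 2) ^ 'n" where
  "plan z t = config (\<lambda>a. comb (fst z) (clamp01 (3 * t)) a
     + \<i> * \<kappa> a * (turn (dir (fst z)) (dir (snd z)) (clamp01 (3 * t - 1)) - dir (fst z) - dir (snd z))
     + comb (snd z) (clamp01 (3 - 3 * t)) a)"

lemma plan_in_X:
  assumes "x \<in> X" "y \<in> X" "t \<in> {0..1}"
  shows "plan (x, y) t \<in> X"
proof -
  consider "t \<le> 1 / 3" | "1 / 3 \<le> t" "t \<le> 2 / 3" | "2 / 3 \<le> t" by linarith
  then show ?thesis
  proof cases
    case 1
    then have c: "clamp01 (3 * t) = 3 * t" "clamp01 (3 * t - 1) = 0" "clamp01 (3 - 3 * t) = 1"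
      using assms by (auto simp: clamp01_def)
    then have "plan (x, y) t = config (comb x (3 * t))"
      unfolding plan_def fst_conv snd_conv c comb_1 by (simp add: algebra_simps)
    then show ?thesis
      using inj_comb[OF assms(1), of "3 * t"] 1 assms by (simp add: config_in_config_space)
  next
    case 2
    then have c: "clamp01 (3 * t) = 1" "clamp01 (3 * t - 1) = 3 * t - 1" "clamp01 (3 - 3 * t) = 1"
      by (auto simp: clamp01_def)
    then have "plan (x, y) t = config (\<lambda>a. \<i> * \<kappa> a * turn (dir x) (dir y) (3 * t - 1))"
      unfolding plan_def fst_conv snd_conv c comb_1 by (simp add: algebra_simps)
    then show ?thesis
      using turn_nonzero[OF norm_dir norm_dir, OF assms(1,2), of "3 * t - 1"] 2 inj_\<kappa>
      by (simp add: config_in_config_space inj_def)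
  next
    case 3
    then have c: "clamp01 (3 * t) = 1" "clamp01 (3 * t - 1) = 1" "clamp01 (3 - 3 * t) = 3 - 3 * t"
      using assms by (auto simp: clamp01_def)
    then have "plan (x, y) t = config (comb y (3 - 3 * t))"
      unfolding plan_def fst_conv snd_conv c comb_1 by (simp add: algebra_simps)
    then show ?thesis
      using inj_comb[OF assms(2), of "3 - 3 * t"] 3 assms by (simp add: config_in_config_space)
  qed
qed

lemma plan_ends:
  assumes "x \<in> X" "y \<in> X"
  shows "plan (x, y) 0 = x" "plan (x, y) 1 = y"
  using assms by (simp_all add: plan_def clamp01_def comb_0 comb_1 algebra_simps)

text \<open>A constant relation \<open>coaligned (g z)\<close> fixes which denominators vanish;
  those summands are 0 throughout and the others are continuous.\<close>

lemma continuous_on_scale [continuous_intros]: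
  assumes g: "continuous_on S g" "\<And>z. z \<in> S \<Longrightarrow> g z \<in> X" and R: "\<And>z. z \<in> S \<Longrightarrow> coaligned (g z) = R"
  shows "continuous_on S (\<lambda>z. scale (g z))"
proof -
  have "continuous_on S (\<lambda>z. \<bar>real (\<kappa> a) - \<kappa> b\<bar> / \<bar>Re (rot (g z) a) - Re (rot (g z) b)\<bar>)" for a b
  proof (cases "(a, b) \<in> R")
    case True
    then have "\<And>z. z \<in> S \<Longrightarrow> Re (rot (g z) a) = Re (rot (g z) b)"
      using R by (auto simp: coaligned_def)
    then show ?thesis by (simp cong: continuous_on_cong)
  next
    case False
    then have "\<And>z. z \<in> S \<Longrightarrow> Re (rot (g z) a) \<noteq> Re (rot (g z) b)"
      using R by (auto simp: coaligned_def)
    then show ?thesis using g by (intro continuous_intros) auto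
  qed
  moreover have "1 + (\<Sum>(a, b)\<in>UNIV. \<bar>real (\<kappa> a) - \<kappa> b\<bar> / \<bar>Re (rot x a) - Re (rot x b)\<bar>) \<noteq> 0" for x
    using scale(1)[of x] by (auto simp: scale_def)
  ultimately show ?thesis
    unfolding scale_def by (intro continuous_intros) (auto simp: case_prod_unfold)
qed

lemma continuous_on_comb:
  assumes "continuous_on S g" "\<And>z. z \<in> S \<Longrightarrow> g z \<in> X" "\<And>z. z \<in> S \<Longrightarrow> coaligned (g z) = R"
    "continuous_on S \<tau>"
  shows "continuous_on S (\<lambda>z. comb (g z) (\<tau> z) a)"
  unfolding comb_def Complex_eq using assms by (intro continuous_intros) auto

lemma continuous_on_turn:
  assumes "continuous_on S d" "continuous_on S d'" "\<And>z. z \<in> S \<Longrightarrow> (d' z = - d z) = opp" "continuous_on S \<tau>"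
  shows "continuous_on S (\<lambda>z. turn (d z) (d' z) (\<tau> z))"
proof (cases opp)
  case True
  have "continuous_on S (\<lambda>z. d z * cis (pi * \<tau> z))"
    using assms by (intro continuous_intros)
  then show ?thesis
    by (rule continuous_on_eq) (use True assms(3) in \<open>simp add: turn_def\<close>)
next
  case False
  have "continuous_on S (\<lambda>z. (1 - \<tau> z) *\<^sub>R d z + \<tau> z *\<^sub>R d' z)"
    using assms by (intro continuous_intros)
  then show ?thesis
    by (rule continuous_on_eq) (use False assms(3) in \<open>simp add: turn_def\<close>)
qed

lemma continuous_on_clamp01 [continuous_intros]:
  "continuous_on S g \<Longrightarrow> continuous_on S (\<lambda>z. clamp01 (g z))"
  unfolding clamp01_def by (intro continuous_intros)

lemma continuous_plan_piece: "continuous_on (piece t \<times> {0..1}) (\<lambda>(z, \<tau>). plan z \<tau>)"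
proof -
  obtain R R' opp where t: "t = (R, R', opp)" by (cases t)
  have p: "fst z \<in> X" "snd z \<in> X" "coaligned (fst z) = R" "coaligned (snd z) = R'"
    "(dir (snd z) = - dir (fst z)) = opp" if "z \<in> piece t" for z
    using that by (auto simp: piece_def t)
  show ?thesis
    unfolding plan_def case_prod_unfold
    by (intro continuous_intros continuous_on_turn continuous_on_comb) (simp_all add: p mem_Times_iff)
qed

text \<open>The pieces are relatively open in the stratum, so continuity on each of them
  suffices.\<close>

lemma continuous_plan: "continuous_on (stratum l \<times> {0..1}) (\<lambda>(z, \<tau>). plan z \<tau>)"
proof (rule continuous_on_openin_partition)
  show "stratum l \<times> {0..1::real} = (\<Union>t\<in>{t. piece t \<inter> stratum l \<noteq> {}}. piece t \<times> {0..1})"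
    by (subst stratum_eq) blast
  fix t assume "t \<in> {t. piece t \<inter> stratum l \<noteq> {}}"
  then show "openin (top_of_set (stratum l \<times> {0..1::real})) (piece t \<times> {0..1})"
    by (intro openin_Times openin_piece) auto
qed (rule continuous_plan_piece)

lemma motion_planner_exists:
  "motion_planner X (2 * CARD('n) - 2) stratum (\<lambda>l z. restrict (plan z) {0..1})"
  unfolding motion_planner_def
proof (intro conjI ballI)
  show "disjoint_family_on stratum {1..2 * CARD('n) - 2}"
    by (auto simp: disjoint_family_on_def stratum_def)
  show "(\<Union>l\<in>{1..2 * CARD('n) - 2}. stratum l) = X \<times> X"
  proof
    show "X \<times> X \<subseteq> (\<Union>l\<in>{1..2 * CARD('n) - 2}. stratum l)"
    proof clarify
      fix x y assume xy: "x \<in> X" "y \<in> X"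
      \<comment> \<open>The sum ranges from \<open>2 + 2 + 0\<close> to
        \<open>2 * CARD('n) + 1\<close>, so subtracting 3 numbers the strata from 1 to
        \<open>2 * CARD('n) - 2\<close>.\<close>
      define l where "l = levels x + levels y + of_bool (dir y \<noteq> - dir x) - 3"
      have b: "2 \<le> levels x" "levels x \<le> CARD('n)" "2 \<le> levels y" "levels y \<le> CARD('n)"
        using levels_bounds xy by auto
      then have "l \<in> {1..2 * CARD('n) - 2}"
        unfolding l_def by (auto simp: of_bool_def)
      moreover have "(x, y) \<in> stratum l"
        using xy b by (simp add: stratum_def l_def)
      ultimately show "(x, y) \<in> (\<Union>l\<in>{1..2 * CARD('n) - 2}. stratum l)"
        by blast
    qed
  qed (auto simp: stratum_def)
  fix l
  show "continuous_map (top_of_set (stratum l)) (path_space (top_of_set X)) (\<lambda>z. restrict (plan z) {0..1})"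
    by (rule joint_imp_continuous_path_space[OF continuous_plan]) (auto simp: stratum_def plan_in_X)
  show "ENR (stratum l)"
    by (rule ENR_stratum)
  fix z assume "z \<in> stratum l"
  then show "path_ends (restrict (plan z) {0..1}) = z"
    by (auto simp: stratum_def path_ends_def plan_ends)
qed

end

section \<open>Bounds for the order of instability\<close>

lemma order_of_instability_set:
  fixes k :: nat
  shows "finite {card I |I. I \<subseteq> {1..k} \<and> (\<Inter>i\<in>I. top_of_set (X \<times> X) closure_of F i) \<noteq> {}}"
    and "{card I |I. I \<subseteq> {1..k} \<and> (\<Inter>i\<in>I. top_of_set (X \<times> X) closure_of F i) \<noteq> {}} \<noteq> {}"
proof -
  have "{card I |I. I \<subseteq> {1..k} \<and> (\<Inter>i\<in>I. top_of_set (X \<times> X) closure_of F i) \<noteq> {}} \<subseteq> card ` Pow {1..k}"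
    by blast
  then show "finite {card I |I. I \<subseteq> {1..k} \<and> (\<Inter>i\<in>I. top_of_set (X \<times> X) closure_of F i) \<noteq> {}}"
    by (rule finite_subset) simp
  have "card {} \<in> {card I |I. I \<subseteq> {1..k} \<and> (\<Inter>i\<in>I. top_of_set (X \<times> X) closure_of F i) \<noteq> {}}"
    by (intro CollectI exI[of _ "{}"]) simp
  then show "{card I |I. I \<subseteq> {1..k} \<and> (\<Inter>i\<in>I. top_of_set (X \<times> X) closure_of F i) \<noteq> {}} \<noteq> {}"
    by blast
qed

lemma order_of_instability_le: "order_of_instability X k F \<le> k"
  unfolding order_of_instability_def
proof (subst Max_le_iff[OF order_of_instability_set], clarify)
  fix I assume "I \<subseteq> {1..k}"
  then show "card I \<le> k" using card_mono[of "{1..k}" I] by simp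
qed

lemma order_of_instability_ge:
  assumes "I \<subseteq> {1..k}" "(\<Inter>i\<in>I. top_of_set (X \<times> X) closure_of F i) \<noteq> {}"
  shows "card I \<le> order_of_instability X k F"
  unfolding order_of_instability_def
  using assms by (intro Max_ge order_of_instability_set) blast

theorem theorem1:
  fixes X :: "((real ^ 2) ^ 'n) set"
  assumes "CARD('n) \<ge> 2"
    and "X = config_space"
  shows "(\<forall>k F s. motion_planner X k F s \<longrightarrow>
            order_of_instability X k F \<ge> 2 * CARD('n) - 2) \<and>
         (\<exists>k F s. motion_planner X k F s \<and>
            order_of_instability X k F = 2 * CARD('n) - 2)"
proof -
  have lower: "2 * CARD('n) - 2 \<le> order_of_instability X k F" if mp: "motion_planner X k F s" for k F s
  proof -
    from motion_planner_lower_bound[OF assms(1) mp[unfolded assms(2)], folded assms(2)]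
    obtain I where I: "I \<subseteq> {1..k}" "(\<Inter>i\<in>I. top_of_set (X \<times> X) closure_of F i) \<noteq> {}"
      "2 * CARD('n) - 2 \<le> card I"
      by (elim exE conjE)
    then show ?thesis
      using order_of_instability_ge[OF I(1,2)] by linarith
  qed
  have "\<not> CARD('n) \<le> Suc 0" using assms(1) by simp
  then obtain a b :: 'n where "a \<noteq> b"
    unfolding card_le_Suc0_iff_eq[OF finite] by blast
  moreover obtain h where "bij_betw h (UNIV :: 'n set) {0..<CARD('n)}"
    using ex_bij_betw_finite_nat[OF finite] by blast
  ultimately interpret anchored a b h
    by unfold_locales (auto simp: bij_betw_def)
  note planner = motion_planner_exists[folded assms(2)]
  \<comment> \<open>This planner has only \<open>2 * CARD('n) - 2\<close> sets, so its order cannot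
    be larger; the lower bound gives equality.\<close>
  have "order_of_instability X (2 * CARD('n) - 2) stratum = 2 * CARD('n) - 2"
    using lower[OF planner] order_of_instability_le by (intro antisym)
  with lower planner show ?thesis
    by blast
qed

end
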